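(* Let $T$ be a regular tournament of order $2n+1\geq 11$ and let $S$ be a subset of $V(T)$ with $|S|\leq \frac{1}{2}(n-2)$. Let $x,y$ be two distinct vertices in $V(T)\setminus S$. If the subtournament $T-S$ contains an $(x,y)$-path of length $r$, where $r\in [3, 2n-|S|-1]$, then $T-S$ also contains an $(x,y)$-path of length $r+1$.
   Context: A tournament is an orientation of a complete graph; it is regular if every vertex has outdegree equal to its indegree. $T-S$ denotes the subtournament induced by $V(T)\setminus S$. Paths are directed and simple; the length of a path is its number of arcs; an $(x,y)$-path is a path from $x$ to $y$. $[a,b]$ denotes the set of integers $\{a,a+1,\dots,b\}$. *)

theory Defs
  imports Main
begin

definition tournament :: "'a set \<Rightarrow> ('a \<Rightarrow> 'a \<Rightarrow> bool) \<Rightarrow> bool" where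
  "tournament V A \<longleftrightarrow> finite V
     \<and> (\<forall>u v. A u v \<longrightarrow> u \<in> V \<and> v \<in> V)
     \<and> (\<forall>v. \<not> A v v)
     \<and> (\<forall>u\<in>V. \<forall>v\<in>V. u \<noteq> v \<longrightarrow> (A u v \<longleftrightarrow> \<not> A v u))"

definition outdeg :: "'a set \<Rightarrow> ('a \<Rightarrow> 'a \<Rightarrow> bool) \<Rightarrow> 'a \<Rightarrow> nat" where
  "outdeg V A v = card {w \<in> V. A v w}"

definition indeg :: "'a set \<Rightarrow> ('a \<Rightarrow> 'a \<Rightarrow> bool) \<Rightarrow> 'a \<Rightarrow> nat" where
  "indeg V A v = card {w \<in> V. A w v}"

definition regular_tournament :: "'a set \<Rightarrow> ('a \<Rightarrow> 'a \<Rightarrow> bool) \<Rightarrow> bool" where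
  "regular_tournament V A \<longleftrightarrow> tournament V A \<and> (\<forall>v\<in>V. outdeg V A v = indeg V A v)"

text \<open>A (simple, directed) path in the subtournament induced by W, given as the list
  of its vertices; its length is the number of arcs, i.e. length of the list minus 1.\<close>
definition is_path :: "'a set \<Rightarrow> ('a \<Rightarrow> 'a \<Rightarrow> bool) \<Rightarrow> 'a list \<Rightarrow> bool" where
  "is_path W A p \<longleftrightarrow> p \<noteq> [] \<and> distinct p \<and> set p \<subseteq> W
     \<and> (\<forall>i. Suc i < length p \<longrightarrow> A (p ! i) (p ! Suc i))"

definition has_path :: "'a set \<Rightarrow> ('a \<Rightarrow> 'a \<Rightarrow> bool) \<Rightarrow> 'a \<Rightarrow> 'a \<Rightarrow> nat \<Rightarrow> bool" where
  "has_path W A x y r \<longleftrightarrow> (\<exists>p. is_path W A p \<and> hd p = x \<and> last p = y \<and> length p = r + 1)"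

end

theory Submission
  imports Defs
begin

text \<open>
  Put \<open>W = V - S\<close> and \<open>m = n - |S|\<close>. All semidegrees in \<open>W\<close> are at least \<open>m \<ge> 4\<close>, and
  \<open>|W| \<le> 3m - 1\<close>. These bounds produce an \<open>(x,y)\<close>-path with \<open>r\<close> inner vertices as follows.

  Two internally disjoint \<open>(x,y)\<close>-paths of a tournament can be merged into one on the union of their
  vertices, as in merge sort. Start from two disjoint routes from \<open>x\<close> to \<open>y\<close> with at most three inner
  vertices each, and let \<open>K\<close> be the set of remaining vertices. By merging, a path inside \<open>K\<close> can
  be absorbed whenever it leads from an out-neighbour of some route vertex \<open>q\<close> to an in-neighbour of some
  route vertex \<open>q'\<close>, provided that \<open>q\<close> and \<open>q'\<close> lie on different routes or that \<open>q\<close> precedes \<open>q'\<close>.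
  If \<open>K\<close> is strong, then for every proper nonempty \<open>Y \<subset> K\<close> some path of any prescribed order
  \<open>g \<ge> 2\<close> leaves \<open>Y\<close>, which forces such an absorption. If \<open>K\<close> is not strong, there are paths of every
  order from its initial to its terminal component, and if none can be absorbed then these components
  receive, respectively send, too few arcs and are too large to fit into \<open>W\<close>.

  Let \<open>Sx\<close> be the set of out-neighbours of \<open>x\<close> and \<open>Ty\<close> the set of in-neighbours of \<open>y\<close>. The two short
  routes are vertices of \<open>Sx \<inter> Ty\<close> or arcs from \<open>Sx\<close> to \<open>Ty\<close>, unless a single vertex meets all of
  these; in that case counting gives two disjoint routes of the form \<open>Sx \<rightarrow> w \<rightarrow> Ty\<close>.
\<close>

section \<open>Routes and merging\<close>

text \<open>Only inner vertices are listed, so a route cut at any of its vertices leaves two routes;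
  the empty list stands for a single arc.\<close>

primrec walk :: "('a \<Rightarrow> 'a \<Rightarrow> bool) \<Rightarrow> 'a \<Rightarrow> 'a list \<Rightarrow> 'a \<Rightarrow> bool" where
  "walk A p [] q \<longleftrightarrow> A p q"
| "walk A p (u # us) q \<longleftrightarrow> A p u \<and> walk A u us q"

lemma walk_append: "walk A p (us @ v # vs) q \<longleftrightarrow> walk A p us v \<and> walk A v vs q"
  by (induction us arbitrary: p) auto

lemma walk_iff_successively:
  "us \<noteq> [] \<Longrightarrow> walk A p us q \<longleftrightarrow> A p (hd us) \<and> successively A us \<and> A (last us) q"
  by (induction us arbitrary: p) (auto simp: successively_Cons)

lemma successively_walk: "successively A (p # us @ [q]) \<longleftrightarrow> walk A p us q"
  by (induction us arbitrary: p) auto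

text \<open>Merging determines which inner vertices occur but not their order, so only their set is
  kept.\<close>

definition spans :: "('a \<Rightarrow> 'a \<Rightarrow> bool) \<Rightarrow> 'a \<Rightarrow> 'a set \<Rightarrow> 'a \<Rightarrow> bool" where
  "spans A p U q \<longleftrightarrow> (\<exists>us. distinct us \<and> set us = U \<and> walk A p us q)"

lemma spansI: "distinct us \<Longrightarrow> walk A p us q \<Longrightarrow> spans A p (set us) q"
  by (auto simp: spans_def)

lemma has_path_if_spans:
  assumes "spans A x U y" "U \<subseteq> W - {x, y}" "x \<in> W" "y \<in> W" "x \<noteq> y" "card U = r"
  shows "has_path W A x y (r + 1)"
proof -
  obtain us where us: "distinct us" "set us = U" "walk A x us y"
    using assms(1) by (auto simp: spans_def)
  have suc: "successively A (x # us @ [y])" using us(3) by (simp add: successively_walk)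
  have nth: "A (p ! i) (p ! Suc i)" if "successively A p" "Suc i < length p" for p i
    using that by (induction p arbitrary: i rule: induct_list012) (auto simp: nth_Cons split: nat.splits)
  have "is_path W A (x # us @ [y])"
    unfolding is_path_def using us assms nth[OF suc] by auto
  moreover have "length us = r" using us assms(6) distinct_card by fastforce
  ultimately show ?thesis unfolding has_path_def by (intro exI[of _ "x # us @ [y]"]) auto
qed

definition gpath :: "('a \<Rightarrow> 'a \<Rightarrow> bool) \<Rightarrow> 'a set \<Rightarrow> nat \<Rightarrow> 'a list \<Rightarrow> bool" where
  "gpath A K g ks \<longleftrightarrow> ks \<noteq> [] \<and> distinct ks \<and> set ks \<subseteq> K \<and> length ks = g \<and> successively A ks"

lemma gpath_rev: "gpath (\<lambda>u v. A v u) K g (rev ks) \<longleftrightarrow> gpath A K g ks"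
  by (auto simp: gpath_def)

definition strong :: "('a \<Rightarrow> 'a \<Rightarrow> bool) \<Rightarrow> 'a set \<Rightarrow> bool" where
  "strong A K \<longleftrightarrow> (\<forall>Y. Y \<subset> K \<longrightarrow> Y \<noteq> {} \<longrightarrow> (\<exists>c\<in>Y. \<exists>d\<in>K - Y. A c d))"

lemma strongE:
  assumes "strong A K" "Y \<subset> K" "Y \<noteq> {}"
  obtains c d where "c \<in> Y" "d \<in> K" "d \<notin> Y" "A c d"
  using assms unfolding strong_def by (metis DiffE)

text \<open>\<open>A\<close> may have arcs outside \<open>W\<close>, so a vertex-deleted
  subtournament keeps the arc relation of the whole tournament.\<close>

locale tournament_on =
  fixes W :: "'a set" and A :: "'a \<Rightarrow> 'a \<Rightarrow> bool"
  assumes fin: "finite W"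
    and irrefl: "\<not> A v v"
    and flip: "u \<in> W \<Longrightarrow> v \<in> W \<Longrightarrow> u \<noteq> v \<Longrightarrow> A u v \<longleftrightarrow> \<not> A v u"
begin

lemma converse: "tournament_on W (\<lambda>u v. A v u)"
  using fin irrefl flip by unfold_locales blast+

text \<open>Compare the first vertices \<open>a\<close> and \<open>b\<close>: if \<open>a\<close>
  dominates \<open>b\<close>, step to \<open>a\<close>, from which the rest of the first route and
  the whole second route both lead to \<open>y\<close>. Only inner vertices are compared, so the
  lemma applies between any two vertices of a route.\<close>

lemma merge_walks:
  assumes "walk A c us y" "walk A c vs y" "set us \<subseteq> W" "set vs \<subseteq> W" "set us \<inter> set vs = {}"
    "distinct us" "distinct vs"
  shows "spans A c (set us \<union> set vs) y"
  using assms
proof (induction "length us + length vs" arbitrary: us vs c rule: less_induct)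
  case less
  show ?case
  proof (cases "us = [] \<or> vs = []")
    case True
    then show ?thesis using less.prems by (auto simp: spans_def)
  next
    case False
    then obtain a us' b vs' where eq: "us = a # us'" "vs = b # vs'"
      by (meson neq_Nil_conv)
    have "A a b \<or> A b a" using flip[of a b] less.prems eq by auto
    then show ?thesis
    proof
      assume "A a b"
      then have "spans A a (set us' \<union> set vs) y"
        using less.prems eq by (intro less.hyps) auto
      then obtain ms where "distinct ms" "set ms = set us' \<union> set vs" "walk A a ms y"
        by (auto simp: spans_def)
      then show ?thesis using less.prems eq
        by (auto simp: spans_def intro!: exI[of _ "a # ms"])
    next
      assume "A b a"
      then have "spans A b (set us \<union> set vs') y"
        using less.prems eq by (intro less.hyps) auto
      then obtain ms where "distinct ms" "set ms = set us \<union> set vs'" "walk A b ms y"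
        by (auto simp: spans_def)
      then show ?thesis using less.prems eq
        by (auto simp: spans_def intro!: exI[of _ "b # ms"])
    qed
  qed
qed

lemma spans_Un:
  assumes "spans A c U y" "spans A c U' y" "U \<subseteq> W" "U' \<subseteq> W" "U \<inter> U' = {}"
  shows "spans A c (U \<union> U') y"
  using assms merge_walks unfolding spans_def by (metis (no_types, lifting) merge_walks spans_def)

text \<open>Absorb \<open>M1\<close> as a second route from \<open>x\<close> to \<open>q'\<close>, and then \<open>L2\<close> as a second route
  from \<open>q\<close> to \<open>y\<close>.\<close>
lemma spans_cross:
  assumes "walk A x (L1 @ q # L2) y" "walk A x (M1 @ q' # M2) y" "walk A q ks q'"
    and dist: "distinct (L1 @ q # L2 @ M1 @ q' # M2 @ ks)"
    and sub: "set (L1 @ q # L2 @ M1 @ q' # M2 @ ks) \<subseteq> W"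
  shows "spans A x (set (L1 @ q # L2 @ M1 @ q' # M2 @ ks)) y"
proof -
  have "walk A x (L1 @ q # ks) q'" "walk A x M1 q'"
    using assms(1-3) by (auto simp: walk_append)
  then have "spans A x (set (L1 @ q # ks) \<union> set M1) q'"
    using dist sub by (intro merge_walks) auto
  then obtain ms where ms: "distinct ms" "set ms = set (L1 @ q # ks) \<union> set M1" "walk A x ms q'"
    by (auto simp: spans_def)
  then obtain m1 m2 where m: "ms = m1 @ q # m2"
    by (metis Un_iff in_set_conv_decomp)
  have "walk A q (m2 @ q' # M2) y" "walk A q L2 y"
    using ms(3) assms(1,2) m by (auto simp: walk_append)
  moreover have "set m2 \<subseteq> set L1 \<union> set ks \<union> set M1" "set m1 \<subseteq> set L1 \<union> set ks \<union> set M1"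
    using ms(1,2) m by auto
  ultimately have "spans A q (set (m2 @ q' # M2) \<union> set L2) y"
    using dist sub ms(1) m by (intro merge_walks) auto
  then obtain ns where ns: "distinct ns" "set ns = set (m2 @ q' # M2) \<union> set L2" "walk A q ns y"
    by (auto simp: spans_def)
  have "walk A x (m1 @ q # ns) y" using ms(3) m ns(3) by (auto simp: walk_append)
  moreover have "distinct (m1 @ q # ns)"
    using ns ms m dist \<open>set m1 \<subseteq> _\<close> by auto
  moreover have "set (m1 @ q # ns) = set (L1 @ q # L2 @ M1 @ q' # M2 @ ks)"
    using ns ms m by auto
  ultimately show ?thesis unfolding spans_def by blast
qed

text \<open>\<open>ks\<close> runs parallel to the segment \<open>L2\<close>, so merging these two
  lengthens the route between \<open>q\<close> and \<open>q'\<close>.\<close>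

lemma spans_forward:
  assumes "walk A x (L1 @ q # L2 @ q' # L3) y" "walk A q ks q'"
    and dist: "distinct (L1 @ q # L2 @ q' # L3 @ ks)"
    and sub: "set (L1 @ q # L2 @ q' # L3 @ ks) \<subseteq> W"
  shows "spans A x (set (L1 @ q # L2 @ q' # L3 @ ks)) y"
proof -
  have "walk A q L2 q'" using assms(1) by (auto simp: walk_append)
  then have "spans A q (set L2 \<union> set ks) q'"
    using assms by (intro merge_walks) auto
  then obtain ms where ms: "distinct ms" "set ms = set L2 \<union> set ks" "walk A q ms q'"
    by (auto simp: spans_def)
  have "walk A x (L1 @ q # ms @ q' # L3) y" using ms(3) assms(1) by (auto simp: walk_append)
  moreover have "distinct (L1 @ q # ms @ q' # L3)" using ms dist by auto
  moreover have "set (L1 @ q # ms @ q' # L3) = set (L1 @ q # L2 @ q' # L3 @ ks)" using ms by auto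
  ultimately show ?thesis unfolding spans_def by blast
qed

text \<open>The detour now starts at \<open>x\<close> and runs parallel to the initial segment
  \<open>L1\<close>; \<open>spans_tail\<close> is the mirror image at \<open>y\<close>.\<close>

lemma spans_head:
  assumes "walk A x (L1 @ q # L2) y" "walk A x ks q"
    and dist: "distinct (L1 @ q # L2 @ ks)"
    and sub: "set (L1 @ q # L2 @ ks) \<subseteq> W"
  shows "spans A x (set (L1 @ q # L2 @ ks)) y"
proof -
  have "walk A x L1 q" using assms(1) by (auto simp: walk_append)
  then have "spans A x (set L1 \<union> set ks) q"
    using assms by (intro merge_walks) auto
  then obtain ms where ms: "distinct ms" "set ms = set L1 \<union> set ks" "walk A x ms q"
    by (auto simp: spans_def)
  have "walk A x (ms @ q # L2) y" using ms(3) assms(1) by (auto simp: walk_append)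
  moreover have "distinct (ms @ q # L2)" using ms dist by auto
  moreover have "set (ms @ q # L2) = set (L1 @ q # L2 @ ks)" using ms by auto
  ultimately show ?thesis unfolding spans_def by blast
qed

lemma spans_tail:
  assumes "walk A x (L1 @ q # L2) y" "walk A q ks y"
    and dist: "distinct (L1 @ q # L2 @ ks)"
    and sub: "set (L1 @ q # L2 @ ks) \<subseteq> W"
  shows "spans A x (set (L1 @ q # L2 @ ks)) y"
proof -
  have "walk A q L2 y" using assms(1) by (auto simp: walk_append)
  then have "spans A q (set L2 \<union> set ks) y"
    using assms by (intro merge_walks) auto
  then obtain ms where ms: "distinct ms" "set ms = set L2 \<union> set ks" "walk A q ms y"
    by (auto simp: spans_def)
  have "walk A x (L1 @ q # ms) y" using ms(3) assms(1) by (auto simp: walk_append)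
  moreover have "distinct (L1 @ q # ms)" using ms dist by auto
  moreover have "set (L1 @ q # ms) = set (L1 @ q # L2 @ ks)" using ms by auto
  ultimately show ?thesis unfolding spans_def by blast
qed

section \<open>Paths with a prescribed number of vertices\<close>

lemma insert_vertex:
  assumes "successively A ks" "distinct ks" "set ks \<subseteq> W" "c \<in> set ks" "A c w" "w \<in> W" "w \<notin> set ks"
  shows "\<exists>ks'. ks' \<noteq> [] \<and> hd ks' = hd ks \<and> set ks' = insert w (set ks) \<and> distinct ks' \<and> successively A ks'"
  using assms(1-5,7)
proof (induction ks arbitrary: c rule: induct_list012)
  case (2 u)
  then show ?case by (intro exI[of _ "[u, w]"]) auto
next
  case (3 u v zs)
  show ?case
  proof (cases "c = u \<and> A w v")
    case True
    then show ?thesis using 3 by (intro exI[of _ "u # w # v # zs"]) auto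
  next
    case False
    \<comment> \<open>As \<open>w\<close> does not fit right after \<open>u\<close> with a known arc
      on both sides, either \<open>c\<close> lies in the tail or \<open>v\<close> itself dominates
      \<open>w\<close>. At the latest, \<open>w\<close> is appended at the end.\<close>
    have "\<exists>c'\<in>set (v # zs). A c' w"
      using False 3 assms(6) flip[of w v] by auto
    then obtain c' where "c' \<in> set (v # zs)" "A c' w" by blast
    with "3.IH"(2)[of c'] obtain ks' where "ks' \<noteq> []" "hd ks' = v" "set ks' = insert w (set (v # zs))"
      "distinct ks'" "successively A ks'" using 3 by auto
    then show ?thesis using 3 by (intro exI[of _ "u # ks'"]) (auto simp: successively_Cons)
  qed
qed simp

text \<open>From \<open>hd ks\<close>, which dominates \<open>w\<close>, to \<open>c\<close>, which
  \<open>w\<close> dominates, the direction switches between two consecutive vertices;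
  \<open>w\<close> fits there.\<close>

lemma insert_between_head:
  assumes "successively A ks" "distinct ks" "set ks \<subseteq> W" "ks \<noteq> []" "A (hd ks) w" "c \<in> set ks" "A w c"
    "w \<in> W" "w \<notin> set ks"
  shows "\<exists>ks'. ks' \<noteq> [] \<and> hd ks' = hd ks \<and> last ks' = last ks \<and> set ks' = insert w (set ks) \<and>
    distinct ks' \<and> successively A ks'"
  using assms(1-7,9)
proof (induction ks rule: induct_list012)
  case (2 u)
  then show ?case using irrefl flip[of u w] assms(8) by auto
next
  case (3 u v zs)
  show ?case
  proof (cases "A w v")
    case True
    then show ?thesis using 3 by (intro exI[of _ "u # w # v # zs"]) auto
  next
    case False
    have "c \<noteq> u" using 3 flip[of u w] assms(8) by auto
    moreover have "A v w" using False 3 assms(8) flip[of w v] by auto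
    ultimately obtain ks' where "ks' \<noteq> []" "hd ks' = v" "last ks' = last (v # zs)"
      "set ks' = insert w (set (v # zs))" "distinct ks'" "successively A ks'"
      using "3.IH"(2) 3 by auto
    then show ?thesis using 3 by (intro exI[of _ "u # ks'"]) (auto simp: successively_Cons)
  qed
qed simp

lemma insert_between:
  assumes "successively A ks" "distinct ks" "set ks \<subseteq> W" "c \<in> set ks" "A c w" "A w (last ks)"
    "w \<in> W" "w \<notin> set ks"
  shows "\<exists>ks'. ks' \<noteq> [] \<and> hd ks' = hd ks \<and> last ks' = last ks \<and> set ks' = insert w (set ks) \<and>
    distinct ks' \<and> successively A ks'"
proof -
  obtain xs ys where ks: "ks = xs @ c # ys" using assms(4) by (meson split_list)
  have "\<exists>zs. zs \<noteq> [] \<and> hd zs = hd (c # ys) \<and> last zs = last (c # ys) \<and> set zs = insert w (set (c # ys)) \<and>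
    distinct zs \<and> successively A zs"
    using assms ks by (intro insert_between_head[where c = "last ks"]) (auto simp: successively_append_iff)
  then obtain zs where zs: "zs \<noteq> []" "hd zs = c" "last zs = last (c # ys)" "set zs = insert w (set (c # ys))"
    "distinct zs" "successively A zs" by auto
  then show ?thesis using assms ks
    by (intro exI[of _ "xs @ zs"]) (auto simp: successively_append_iff hd_append)
qed

text \<open>Grow the path: its vertices contain \<open>u\<close>, so by \<open>esc\<close> some arc
  leaves them, and \<open>insert_vertex\<close> absorbs the end of that arc without moving the first
  vertex.\<close>

lemma gpath_from:
  assumes "K \<subseteq> W" "u \<in> K"
    and esc: "\<And>Y. u \<in> Y \<Longrightarrow> Y \<subset> K \<Longrightarrow> \<exists>c\<in>Y. \<exists>d\<in>K - Y. A c d"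
    and "1 \<le> g" "g \<le> card K"
  obtains ks where "gpath A K g ks" "hd ks = u"
proof -
  have "\<exists>ks. gpath A K g ks \<and> hd ks = u" using assms(4,5)
  proof (induction g rule: nat_induct_at_least)
    case base
    then show ?case using assms(2) by (intro exI[of _ "[u]"]) (auto simp: gpath_def)
  next
    case (Suc g)
    then obtain ks where ks: "ks \<noteq> []" "distinct ks" "set ks \<subseteq> K" "length ks = g" "successively A ks" "hd ks = u"
      by (auto simp: gpath_def)
    have "card (set ks) < card K" using ks Suc by (simp add: distinct_card)
    then have "set ks \<subset> K" using ks(3) by auto
    moreover have "u \<in> set ks" using ks by auto
    ultimately have "\<exists>c\<in>set ks. \<exists>d\<in>K - set ks. A c d" by (intro esc)
    then obtain c d where cd: "c \<in> set ks" "d \<in> K" "d \<notin> set ks" "A c d" by blast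
    have "set ks \<subseteq> W" "d \<in> W" using assms(1) ks(3) cd(2) by auto
    from insert_vertex[OF ks(5,2) this(1) cd(1,4) this(2) cd(3)]
    obtain ks' where ks': "ks' \<noteq> []" "hd ks' = hd ks" "set ks' = insert d (set ks)"
      "distinct ks'" "successively A ks'"
      by (elim exE conjE)
    have "length ks' = Suc g"
      using ks'(3,4) ks(2,4) cd(3) by (metis List.finite_set card_insert_disjoint distinct_card)
    then show ?case using ks' ks cd by (intro exI[of _ ks']) (auto simp: gpath_def)
  qed
  then show ?thesis using that by blast
qed

lemma gpath_to:
  assumes "K \<subseteq> W" "v \<in> K"
    and "\<And>Y. v \<in> Y \<Longrightarrow> Y \<subset> K \<Longrightarrow> \<exists>c\<in>Y. \<exists>d\<in>K - Y. A d c"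
    and "1 \<le> g" "g \<le> card K"
  obtains ks where "gpath A K g ks" "last ks = v"
proof -
  interpret c: tournament_on W "\<lambda>u v. A v u" by (rule converse)
  obtain ks where "gpath (\<lambda>u v. A v u) K g ks" "hd ks = v"
    using c.gpath_from[OF assms] by blast
  then show ?thesis using that[of "rev ks"] gpath_rev[of A K g "rev ks"] by (auto simp: last_rev)
qed

lemma strong_gpath_leaving:
  assumes "K \<subseteq> W" "strong A K" "Y \<subset> K" "Y \<noteq> {}" "2 \<le> g" "g \<le> card K"
  obtains ks where "gpath A K g ks" "hd ks \<in> Y" "last ks \<in> K - Y"
proof -
  have finK: "finite K" using assms(1) fin finite_subset by blast
  have "\<exists>ks. gpath A K g ks \<and> hd ks \<in> Y \<and> last ks \<in> K - Y" using assms(5,6)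
  proof (induction g rule: nat_induct_at_least)
    case base
    obtain c d where "c \<in> Y" "d \<in> K" "d \<notin> Y" "A c d" using strongE[OF assms(2-4)] by blast
    then show ?case using assms(3) by (intro exI[of _ "[c, d]"]) (auto simp: gpath_def)
  next
    case (Suc g)
    then obtain ks where ks: "ks \<noteq> []" "distinct ks" "set ks \<subseteq> K" "length ks = g" "successively A ks"
      "hd ks \<in> Y" "last ks \<in> K - Y" by (auto simp: gpath_def)
    show ?case
    proof (rule ccontr)
      assume non: "\<nexists>ks. gpath A K (Suc g) ks \<and> hd ks \<in> Y \<and> last ks \<in> K - Y"
      have noins: False if "ks' \<noteq> []" "hd ks' \<in> Y" "last ks' \<in> K - Y" "set ks' = insert w (set ks)"
        "distinct ks'" "successively A ks'" "w \<in> K" "w \<notin> set ks" for ks' w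
      proof -
        have "length ks' = Suc g" using that ks
          by (metis List.finite_set card_insert_disjoint distinct_card)
        then have "gpath A K (Suc g) ks'" using that ks by (auto simp: gpath_def)
        then show False using non that by blast
      qed
      have ksW: "set ks \<subseteq> W" using ks assms(1) by auto
      have ends: "hd ks \<in> set ks" "last ks \<in> set ks" using ks(1) by auto
      \<comment> \<open>A vertex of \<open>Y\<close> dominating a path vertex could be put in front
        of the path or inserted between its ends.\<close>
      have 1: "A c w" if w: "w \<in> Y" "w \<notin> set ks" "c \<in> set ks" for c w
      proof (rule ccontr)
        assume "\<not> A c w"
        have wK: "w \<in> K" "w \<in> W" using w assms(1,3) by auto
        then have wc: "A w c" using \<open>\<not> A c w\<close> flip[of w c] w ksW by auto
        have "\<not> A w (hd ks)"
          using noins[of "w # ks" w] ks w wK by (auto simp: successively_Cons)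
        then have "A (hd ks) w" using flip[of w "hd ks"] wK ksW w ends by auto
        then obtain ks' where "ks' \<noteq> []" "hd ks' = hd ks" "last ks' = last ks" "set ks' = insert w (set ks)"
          "distinct ks'" "successively A ks'"
          using insert_between_head[OF ks(5,2) ksW ks(1) _ w(3) wc wK(2) w(2)] by blast
        then show False using noins[of ks' w] ks w wK by auto
      qed
      have 2: "A w c" if w: "w \<in> K - Y" "w \<notin> set ks" "c \<in> set ks" for c w
      proof (rule ccontr)
        assume "\<not> A w c"
        have wK: "w \<in> K" "w \<in> W" using w assms(1) by auto
        then have cw: "A c w" using \<open>\<not> A w c\<close> flip[of w c] w ksW by auto
        have "\<not> A (last ks) w"
          using noins[of "ks @ [w]" w] ks w wK by (auto simp: successively_append_iff)
        then have "A w (last ks)" using flip[of w "last ks"] wK ksW w ends by auto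
        then obtain ks' where "ks' \<noteq> []" "hd ks' = hd ks" "last ks' = last ks" "set ks' = insert w (set ks)"
          "distinct ks'" "successively A ks'"
          using insert_between[OF ks(5,2) ksW w(3) cw _ wK(2) w(2)] by blast
        then show False using noins[of ks' w] ks w wK by auto
      qed
      \<comment> \<open>Otherwise trade the last vertex for \<open>w\<close> and \<open>w'\<close>,
        gaining one; as \<open>2 \<le> g\<close>, the shortened path is nonempty.\<close>
      have 3: "\<not> A w w'" if w: "w \<in> Y" "w \<notin> set ks" "w' \<in> K - Y" "w' \<notin> set ks" for w w'
      proof
        assume ww: "A w w'"
        let ?b = "butlast ks"
        have b: "?b \<noteq> []" "ks = ?b @ [last ks]" using ks Suc by (auto simp: neq_Nil_conv Suc_le_eq)
        have "successively A ?b" using ks(5) b(2) by (metis successively_append_iff)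
        moreover have "A (last ?b) w" using 1 w b(1) by (meson in_set_butlastD last_in_set)
        ultimately have "successively A (?b @ [w, w'])" using ww b by (auto simp: successively_append_iff)
        moreover have hdb: "hd (?b @ [w, w']) = hd ks" using b by (metis hd_append2)
        moreover have "distinct (?b @ [w, w'])" using ks w by (auto simp: distinct_butlast dest: in_set_butlastD)
        moreover have "set (?b @ [w, w']) \<subseteq> K" using ks w assms(3) by (auto dest: in_set_butlastD)
        moreover have "length (?b @ [w, w']) = Suc g" using ks Suc by auto
        ultimately have "gpath A K (Suc g) (?b @ [w, w'])" by (simp add: gpath_def)
        moreover have "last (?b @ [w, w']) = w'" by simp
        ultimately show False using non ks(6) w(3) hdb by metis
      qed
      define Q where "Q = K - Y - set ks"
      define Y' where "Y' = Y - set ks"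
      show False
      proof (cases "Q = {}")
        case False
        \<comment> \<open>Facts 2 and 3 say that no arc enters \<open>Q\<close>.\<close>
        have "K - Q \<subset> K" "K - Q \<noteq> {}" using False ks unfolding Q_def by auto
        then obtain c d where "c \<in> K - Q" "d \<in> K" "d \<notin> K - Q" "A c d" by (rule strongE[OF assms(2)])
        then have cd: "c \<in> K - Q" "d \<in> Q" "A c d" by auto
        then have "c \<notin> set ks" using 2[of d c] flip[of c d] assms(1) irrefl unfolding Q_def by auto
        then show False using cd 3[of c d] unfolding Q_def by auto
      next
        case True
        have "card (set ks) < card K" using ks Suc by (simp add: distinct_card)
        then have "set ks \<noteq> K" by auto
        then have "Y' \<noteq> {}" using True ks(3) unfolding Y'_def Q_def by auto
        moreover have "Y' \<subset> K" using assms(3) unfolding Y'_def by auto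
        ultimately obtain c d where cd: "c \<in> Y'" "d \<in> K" "d \<notin> Y'" "A c d"
          by - (rule strongE[OF assms(2)])
        then have "d \<in> set ks" using True unfolding Q_def Y'_def by auto
        then show False using 1[of c d] cd flip[of c d] assms(1,3) irrefl unfolding Y'_def by auto
      qed
    qed
  qed
  then show ?thesis using that by blast
qed

section \<open>Degree averages and tournaments that are not strong\<close>

lemma total: "u \<in> W \<Longrightarrow> v \<in> W \<Longrightarrow> u \<noteq> v \<Longrightarrow> \<not> A v u \<Longrightarrow> A u v"
  using flip by blast

lemma asym: "A u v \<Longrightarrow> u \<in> W \<Longrightarrow> v \<in> W \<Longrightarrow> \<not> A v u"
  using flip irrefl by blast

text \<open>Inside \<open>K\<close> in- and outdegrees have equal sums and add up to
  \<open>card K - 1\<close> at each vertex, so the average indegree is half of that.\<close>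

lemma few_in_neighbours:
  assumes "K \<subseteq> W" "K \<noteq> {}"
  obtains u where "u \<in> K" "2 * card {w \<in> K. A w u} + 1 \<le> card K"
proof -
  have finK: "finite K" using assms(1) fin finite_subset by blast
  let ?i = "\<lambda>u. card {w \<in> K. A w u}" and ?o = "\<lambda>u. card {w \<in> K. A u w}"
  have io: "?i u + ?o u = card K - 1" if "u \<in> K" for u
  proof -
    have "{w \<in> K. A w u} \<union> {w \<in> K. A u w} = K - {u}"
      using that assms(1) flip[of u] irrefl by blast
    moreover have "{w \<in> K. A w u} \<inter> {w \<in> K. A u w} = {}"
      using that assms(1) flip[of u] irrefl by blast
    ultimately show ?thesis
      using card_Un_disjoint[of "{w \<in> K. A w u}" "{w \<in> K. A u w}"] finK that by simp
  qed
  have "(\<Sum>u\<in>K. ?i u) = (\<Sum>u\<in>K. ?o u)"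
  proof -
    have "(\<Sum>u\<in>K. ?i u) = (\<Sum>u\<in>K. \<Sum>w\<in>K. if A w u then 1 else 0)"
      using finK by (simp add: sum.If_cases Int_def)
    also have "\<dots> = (\<Sum>w\<in>K. \<Sum>u\<in>K. if A w u then 1 else 0)" by (rule sum.swap)
    also have "\<dots> = (\<Sum>u\<in>K. ?o u)" using finK by (simp add: sum.If_cases Int_def)
    finally show ?thesis .
  qed
  moreover have "(\<Sum>u\<in>K. ?i u) + (\<Sum>u\<in>K. ?o u) = card K * (card K - 1)"
    using io by (simp flip: sum.distrib)
  ultimately have tot: "2 * (\<Sum>u\<in>K. ?i u) = card K * (card K - 1)" by simp
  have pos: "card K > 0" using finK assms(2) by (simp add: card_gt_0_iff)
  have "\<exists>u\<in>K. 2 * ?i u + 1 \<le> card K"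
  proof (rule ccontr)
    assume "\<not> ?thesis"
    then have "\<And>u. u \<in> K \<Longrightarrow> card K \<le> 2 * ?i u" by fastforce
    then have "(\<Sum>u\<in>K. card K) \<le> (\<Sum>u\<in>K. 2 * ?i u)" by (intro sum_mono) auto
    then have "card K * card K \<le> card K * (card K - 1)" using tot by (simp flip: sum_distrib_left)
    then show False using pos by simp
  qed
  then show ?thesis using that by blast
qed

lemma few_out_neighbours:
  assumes "K \<subseteq> W" "K \<noteq> {}"
  obtains u where "u \<in> K" "2 * card {w \<in> K. A u w} + 1 \<le> card K"
proof -
  interpret c: tournament_on W "\<lambda>u v. A v u" by (rule converse)
  show ?thesis using c.few_in_neighbours[OF assms] that by blast
qed

text \<open>\<open>I\<close> and \<open>J\<close> are the initial and terminal strong components,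
  found as minimal dominating and minimal dominated sets. The paths consist of a piece inside
  \<open>I\<close> followed by a piece inside \<open>K - I\<close>.\<close>

lemma not_strong_decomposition:
  assumes KW: "K \<subseteq> W" and "\<not> strong A K"
  obtains I J where "I \<noteq> {}" "J \<noteq> {}" "I \<subseteq> K" "J \<subseteq> K" "I \<inter> J = {}"
    "\<forall>u\<in>I. \<forall>w\<in>K - I. A u w" "\<forall>v\<in>J. \<forall>w\<in>K - J. A w v"
    "\<forall>u\<in>I. \<forall>v\<in>J. \<forall>g. 2 \<le> g \<longrightarrow> g \<le> card K \<longrightarrow> (\<exists>ks. gpath A K g ks \<and> hd ks = u \<and> last ks = v)"
proof -
  have finK: "finite K" using KW fin finite_subset by blast
  let ?ini = "\<lambda>I. I \<noteq> {} \<and> I \<subset> K \<and> (\<forall>u\<in>I. \<forall>w\<in>K - I. A u w)"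
  obtain Y where Y: "Y \<subset> K" "Y \<noteq> {}" "\<forall>c\<in>Y. \<forall>d\<in>K - Y. \<not> A c d"
    using assms(2) unfolding strong_def by blast
  have "A u w" if "u \<in> K - Y" "w \<in> Y" for u w
    using that Y KW by (intro total) auto
  then have "?ini (K - Y)" using Y by blast
  from ex_has_least_nat[of ?ini, OF this, of card]
  obtain I where least: "?ini I \<and> (\<forall>I'. ?ini I' \<longrightarrow> card I \<le> card I')"
    by (elim exE)
  note I = conjunct1[OF least] and Imin = conjunct2[OF least]
  let ?L = "K - I"
  let ?ter = "\<lambda>J. J \<noteq> {} \<and> J \<subseteq> ?L \<and> (\<forall>v\<in>J. \<forall>w\<in>K - J. A w v)"
  have "?ter ?L" using I by auto
  from ex_has_least_nat[of ?ter, OF this, of card]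
  obtain J where least: "?ter J \<and> (\<forall>J'. ?ter J' \<longrightarrow> card J \<le> card J')"
    by (elim exE)
  note J = conjunct1[OF least] and Jmin = conjunct2[OF least]
  \<comment> \<open>If no arc left \<open>Y\<close> inside \<open>I\<close>, then
    \<open>I - Y\<close> would be a smaller dominating set.\<close>
  have escI: "\<exists>c\<in>Y. \<exists>d\<in>I - Y. A c d" if uY: "u \<in> Y" "Y \<subset> I" for u Y
  proof (rule ccontr)
    assume n: "\<not> ?thesis"
    have "A c d" if "c \<in> I - Y" "d \<in> Y" for c d
      using n that I KW \<open>Y \<subset> I\<close> by (intro total) auto
    then have "?ini (I - Y)" using uY I by blast
    then have "card I \<le> card (I - Y)" by (rule Imin[rule_format])
    moreover have "card (I - Y) < card I"
      using uY I finK by (intro psubset_card_mono) (auto intro: finite_subset)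
    ultimately show False by simp
  qed
  \<comment> \<open>Otherwise \<open>Y\<close> dominates the rest of \<open>K - I\<close>:
    impossible if \<open>J \<subseteq> Y\<close>, since that rest dominates \<open>J\<close>; if
    not, \<open>J - Y\<close> is a smaller dominated set.\<close>
  have escL: "\<exists>c\<in>Y. \<exists>d\<in>?L - Y. A d c" if vY: "v \<in> J" "v \<in> Y" "Y \<subset> ?L" for v Y
  proof (rule ccontr)
    assume n: "\<not> ?thesis"
    have YZ: "A c d" if "c \<in> Y" "d \<in> ?L - Y" for c d
      using n that \<open>Y \<subset> ?L\<close> KW flip[of c d] by blast
    show False
    proof (cases "J \<subseteq> Y")
      case True
      obtain d where d: "d \<in> ?L - Y" using vY by blast
      then have "A d v" using J True vY by blast
      moreover have "A v d" using YZ d vY by blast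
      ultimately show False using flip[of d v] d vY KW irrefl by blast
    next
      case False
      have "?ter (J - Y)" using J YZ False by blast
      then have "card J \<le> card (J - Y)" by (rule Jmin[rule_format])
      moreover have "card (J - Y) < card J"
        using vY J finK by (intro psubset_card_mono) (auto intro: finite_subset)
      ultimately show False by simp
    qed
  qed
  have paths: "\<exists>ks. gpath A K g ks \<and> hd ks = u \<and> last ks = v"
    if uv: "u \<in> I" "v \<in> J" and g: "2 \<le> g" "g \<le> card K" for u v g
  proof -
    have cK: "card K = card I + card ?L"
      using I finK by (metis card_Diff_subset card_mono finite_subset le_add_diff_inverse psubset_imp_subset)
    have "card I \<ge> 1" "card ?L \<ge> 1"
      using I J finK by (auto simp: Suc_le_eq card_gt_0_iff intro: finite_subset)
    \<comment> \<open>\<open>I\<close> gets as few vertices as possible: at least one, and enough to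
      leave at most \<open>card ?L\<close> for the second piece.\<close>
    then obtain i j where ij: "1 \<le> i" "i \<le> card I" "1 \<le> j" "j \<le> card ?L" "i + j = g"
      using g cK by (intro that[of "max 1 (g - card ?L)" "g - max 1 (g - card ?L)"]) auto
    obtain us where us: "gpath A I i us" "hd us = u"
      using gpath_from[of I u i] KW I uv escI ij by (metis order.trans psubset_imp_subset)
    have "?L \<subseteq> W" "v \<in> ?L" using KW J uv by auto
    then obtain vs where vs: "gpath A ?L j vs" "last vs = v"
      using gpath_to[of ?L v j] escL[OF uv(2)] ij by metis
    have "A (last us) (hd vs)"
      using I us vs unfolding gpath_def by (meson hd_in_set last_in_set subset_iff)
    then have "gpath A K g (us @ vs)"
      using us vs I ij unfolding gpath_def by (auto simp: successively_append_iff)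
    then show ?thesis using us vs unfolding gpath_def
      by (intro exI[of _ "us @ vs"]) auto
  qed
  show ?thesis
    using I J paths by (intro that[of I J]) auto
qed

end

section \<open>Absorbing vertices into two routes\<close>

text \<open>All of \<open>T\<close> sits weakly before all of \<open>S\<close> in the list, so at
  most one vertex is counted twice. This will bound jointly the route vertices sending arcs to the
  initial component of \<open>K\<close> and those receiving arcs from the terminal one.\<close>

lemma card_ordered_pair_le:
  assumes "distinct xs" "S \<subseteq> set xs" "T \<subseteq> set xs"
    and "\<And>L1 q L2 q' L3. xs = L1 @ q # L2 @ q' # L3 \<Longrightarrow> q \<in> S \<Longrightarrow> q' \<in> T \<Longrightarrow> False"
  shows "card S + card T \<le> length xs + 1"
  using assms
proof (induction xs arbitrary: S T)
  case (Cons u zs)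
  have ord: "q \<notin> S \<or> q' \<notin> T" if "u # zs = L1 @ q # L2 @ q' # L3" for L1 q L2 q' L3
    using Cons.prems(4)[OF that] by blast
  show ?case
  proof (cases "u \<in> S")
    case True
    have "q' \<notin> T" if "q' \<in> set zs" for q'
      using that ord[of "[]" u _ q'] True by (metis append_Nil split_list)
    then have "T \<subseteq> {u}" using Cons.prems(3) by auto
    then have "card T \<le> 1" using card_mono[of "{u}" T] by simp
    moreover have "card S \<le> length (u # zs)"
      using card_mono[OF _ Cons.prems(2)] Cons.prems(1) by (metis List.finite_set distinct_card)
    ultimately show ?thesis by simp
  next
    case False
    have "card S + card (T - {u}) \<le> length zs + 1"
    proof (rule Cons.IH)
      show "S \<subseteq> set zs" "T - {u} \<subseteq> set zs" "distinct zs" using Cons.prems False by auto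
      fix L1 q L2 q' L3 assume "zs = L1 @ q # L2 @ q' # L3" "q \<in> S" "q' \<in> T - {u}"
      then show False using ord[of "u # L1" q L2 q' L3] by auto
    qed
    moreover have "card T \<le> card (T - {u}) + 1"
      by (metis Suc_eq_plus1 card.infinite card_Diff_singleton_if le_add1 le_refl card_Suc_Diff1
          finite_Diff_insert Diff_empty Diff_insert0)
    ultimately show ?thesis by simp
  qed
qed simp

locale terminals = tournament_on W A for W :: "'a set" and A +
  fixes x y :: 'a and m :: nat
  assumes xW: "x \<in> W" and yW: "y \<in> W" and xy: "x \<noteq> y"
    and outdeg_ge: "v \<in> W \<Longrightarrow> m \<le> card {w \<in> W. A v w}"
    and indeg_ge: "v \<in> W \<Longrightarrow> m \<le> card {w \<in> W. A w v}"
    and card_W: "card W + 1 \<le> 3 * m" and m_ge: "4 \<le> m"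
begin

text \<open>\<open>r\<close> counts inner vertices, so the path has length
  \<open>r + 1\<close>.\<close>

definition "attains r \<longleftrightarrow> (\<exists>U \<subseteq> W - {x, y}. card U = r \<and> spans A x U y)"

lemma attains_list:
  assumes "distinct us" "set us \<subseteq> W - {x, y}" "walk A x us y" "length us = r"
  shows "attains r"
  using assms distinct_card[OF assms(1)] spansI[OF assms(1,3)] unfolding attains_def by blast

end

text \<open>By the degree bounds, a vertex as in \<open>few_in\<close> has an in-neighbour off the
  routes and one as in \<open>few_out\<close> an out-neighbour; so the routes neither dominate all
  remaining vertices nor are dominated by all of them.\<close>

locale two_routes = terminals W A x y m for W :: "'a set" and A x y m +
  fixes P1 P2 :: "'a list"
  assumes nonempty: "P1 \<noteq> []" "P2 \<noteq> []"
    and dist: "distinct P1" "distinct P2" "set P1 \<inter> set P2 = {}"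
    and sub: "set P1 \<subseteq> W - {x, y}" "set P2 \<subseteq> W - {x, y}"
    and route: "walk A x P1 y" "walk A x P2 y"
    and short: "length P1 \<le> 3" "length P2 \<le> 3"
    and few_in: "\<exists>q\<in>set P1 \<union> set P2. card {u \<in> set P1 \<union> set P2 \<union> {x, y}. A u q} < m"
    and few_out: "\<exists>q\<in>set P1 \<union> set P2. card {u \<in> set P1 \<union> set P2 \<union> {x, y}. A q u} < m"
begin

lemma swap: "two_routes W A x y m P2 P1"
  using nonempty dist sub route short few_in few_out
  by unfold_locales (auto simp: Un_commute Int_commute)

definition "P = set P1 \<union> set P2"
definition "K = W - {x, y} - P"
lemma P_swap: "two_routes.P P2 P1 = P"
  using two_routes.P_def[OF swap] P_def by auto

lemma K_swap: "two_routes.K W x y P2 P1 = K"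
  using two_routes.K_def[OF swap] K_def P_swap by auto

lemma KW: "K \<subseteq> W" by (auto simp: K_def)

lemma finP: "finite P" by (simp add: P_def)
lemma finK: "finite K" using fin by (simp add: K_def)

lemma PW: "P \<subseteq> W - {x, y}" using sub by (auto simp: P_def)

lemma cardP: "card P = length P1 + length P2"
  using dist by (simp add: P_def card_Un_disjoint distinct_card)

lemma cardK: "card K + card P + 2 = card W"
proof -
  have "W = K \<union> P \<union> {x, y}" using PW xW yW by (auto simp: K_def)
  moreover have "card (K \<union> P \<union> {x, y}) = card (K \<union> P) + card {x, y}"
    using PW finP finK by (intro card_Un_disjoint) (auto simp: K_def)
  moreover have "card (K \<union> P) = card K + card P"
    using finP finK by (intro card_Un_disjoint) (auto simp: K_def)
  ultimately show ?thesis using xy by simp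
qed

lemma spans_P: "spans A x P y"
  unfolding P_def using dist sub route by (intro merge_walks) auto

lemma attains_P: "attains (card P)"
  using spans_P PW by (auto simp: attains_def)

lemma attains_if_spans:
  assumes "spans A x (P \<union> set ks) y" "set ks \<subseteq> K" "distinct ks"
  shows "attains (card P + length ks)"
proof -
  have "card (P \<union> set ks) = card P + length ks"
    using assms finP by (subst card_Un_disjoint) (auto simp: K_def distinct_card)
  then show ?thesis using assms PW unfolding attains_def
    by (intro exI[of _ "P \<union> set ks"]) (auto simp: K_def)
qed

lemma off_routes: "set ks \<subseteq> K \<Longrightarrow> set ks \<subseteq> W \<and> set ks \<inter> set P1 = {} \<and> set ks \<inter> set P2 = {}"
  by (auto simp: K_def P_def)

text \<open>It is enough to absorb \<open>ks\<close> into \<open>P1\<close>: \<open>P2\<close> is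
  still a disjoint route and is merged in afterwards.\<close>

lemma attains_if_spans1:
  assumes "spans A x (set P1 \<union> set ks) y" "set ks \<subseteq> K" "distinct ks"
  shows "attains (card P + length ks)"
proof -
  have "spans A x ((set P1 \<union> set ks) \<union> set P2) y"
    by (rule spans_Un[OF assms(1) spansI[OF dist(2) route(2)]])
      (use dist(3) sub off_routes[OF assms(2)] in blast)+
  moreover have "(set P1 \<union> set ks) \<union> set P2 = P \<union> set ks" by (auto simp: P_def)
  ultimately show ?thesis using assms(2,3) attains_if_spans by metis
qed

lemma attains_cross:
  assumes "q \<in> set P1" "q' \<in> set P2" "walk A q ks q'" "set ks \<subseteq> K" "distinct ks"
  shows "attains (card P + length ks)"
proof -
  obtain L1 L2 where 1: "P1 = L1 @ q # L2" using assms(1) by (meson split_list)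
  obtain M1 M2 where 2: "P2 = M1 @ q' # M2" using assms(2) by (meson split_list)
  have "spans A x (set (L1 @ q # L2 @ M1 @ q' # M2 @ ks)) y"
    using route assms(3,5) dist sub off_routes[OF assms(4)] unfolding 1 2
    by (intro spans_cross) auto
  moreover have "set (L1 @ q # L2 @ M1 @ q' # M2 @ ks) = P \<union> set ks" unfolding P_def unfolding 1 2 by auto
  ultimately show ?thesis using assms(4,5) attains_if_spans by metis
qed

lemma attains_forward:
  assumes "P1 = L1 @ q # L2 @ q' # L3" "walk A q ks q'" "set ks \<subseteq> K" "distinct ks"
  shows "attains (card P + length ks)"
proof -
  have "spans A x (set (L1 @ q # L2 @ q' # L3 @ ks)) y"
    using route assms(2,4) dist sub off_routes[OF assms(3)] unfolding assms(1)
    by (intro spans_forward) auto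
  moreover have "set (L1 @ q # L2 @ q' # L3 @ ks) = set P1 \<union> set ks" by (auto simp: assms(1))
  ultimately have "spans A x (set P1 \<union> set ks) y" by simp
  then show ?thesis using assms(3,4) by (rule attains_if_spans1)
qed

lemma attains_head1:
  assumes "q \<in> set P1" "walk A x ks q" "set ks \<subseteq> K" "distinct ks"
  shows "attains (card P + length ks)"
proof -
  obtain L1 L2 where 1: "P1 = L1 @ q # L2" using assms(1) by (meson split_list)
  have "spans A x (set (L1 @ q # L2 @ ks)) y"
    using route assms(2,4) dist sub off_routes[OF assms(3)] unfolding 1
    by (intro spans_head) auto
  moreover have "set (L1 @ q # L2 @ ks) = set P1 \<union> set ks" by (auto simp: 1)
  ultimately have "spans A x (set P1 \<union> set ks) y" by simp
  then show ?thesis using assms(3,4) by (rule attains_if_spans1)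
qed

lemma attains_tail1:
  assumes "q \<in> set P1" "walk A q ks y" "set ks \<subseteq> K" "distinct ks"
  shows "attains (card P + length ks)"
proof -
  obtain L1 L2 where 1: "P1 = L1 @ q # L2" using assms(1) by (meson split_list)
  have "spans A x (set (L1 @ q # L2 @ ks)) y"
    using route assms(2,4) dist sub off_routes[OF assms(3)] unfolding 1
    by (intro spans_tail) auto
  moreover have "set (L1 @ q # L2 @ ks) = set P1 \<union> set ks" by (auto simp: 1)
  ultimately have "spans A x (set P1 \<union> set ks) y" by simp
  then show ?thesis using assms(3,4) by (rule attains_if_spans1)
qed

text \<open>Here \<open>ks\<close> is itself a third route.\<close>

lemma attains_xy:
  assumes "walk A x ks y" "set ks \<subseteq> K" "distinct ks"
  shows "attains (card P + length ks)"
proof -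
  have "spans A x (P \<union> set ks) y"
    using spans_Un[OF spans_P spansI[OF assms(3,1)]] assms(2) PW KW by (auto simp: K_def)
  then show ?thesis using assms attains_if_spans by metis
qed

end

section \<open>Exchanging the routes, and the three cases of absorption\<close>

context two_routes
begin

interpretation s: two_routes W A x y m P2 P1 by (rule swap)

lemma attains_cross2:
  assumes "q \<in> set P2" "q' \<in> set P1" "walk A q ks q'" "set ks \<subseteq> K" "distinct ks"
  shows "attains (card P + length ks)"
  using s.attains_cross[OF assms(1-3)] assms(4,5) by (simp add: P_swap K_swap)

lemma attains_forward2:
  assumes "P2 = L1 @ q # L2 @ q' # L3" "walk A q ks q'" "set ks \<subseteq> K" "distinct ks"
  shows "attains (card P + length ks)"
  using s.attains_forward[OF assms(1-2)] assms(3,4) by (simp add: P_swap K_swap)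

lemma attains_head:
  assumes "q \<in> P" "walk A x ks q" "set ks \<subseteq> K" "distinct ks"
  shows "attains (card P + length ks)"
proof (cases "q \<in> set P1")
  case False
  then have "q \<in> set P2" using assms(1) by (simp add: P_def)
  then show ?thesis using s.attains_head1[of q ks] assms(2-4) by (simp add: P_swap K_swap)
qed (use assms attains_head1 in simp)

lemma attains_tail:
  assumes "q \<in> P" "walk A q ks y" "set ks \<subseteq> K" "distinct ks"
  shows "attains (card P + length ks)"
proof (cases "q \<in> set P1")
  case False
  then have "q \<in> set P2" using assms(1) by (simp add: P_def)
  then show ?thesis using s.attains_tail1[of q ks] assms(2-4) by (simp add: P_swap K_swap)
qed (use assms attains_tail1 in simp)

lemma walk_gpath: "gpath A K g ks \<Longrightarrow> A q (hd ks) \<Longrightarrow> A (last ks) q' \<Longrightarrow> walk A q ks q'"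
  by (simp add: gpath_def walk_iff_successively)

lemma gpath_ends: "gpath A K g ks \<Longrightarrow> hd ks \<in> K \<and> last ks \<in> K"
  unfolding gpath_def by (meson hd_in_set last_in_set subsetD)

text \<open>The summand 1 pays for \<open>y\<close>, whose outgoing arcs are of no use on an
  \<open>(x,y)\<close>-path; in the dual lemma it pays for \<open>x\<close>.\<close>

lemma in_neighbours_of_K:
  assumes "u \<in> W" "\<And>w. w \<in> K \<Longrightarrow> A w u \<Longrightarrow> w \<in> I" "\<And>w. w \<in> P \<union> {x} \<Longrightarrow> A w u \<Longrightarrow> w \<in> S"
    "finite I" "finite S"
  shows "m \<le> card {w \<in> I. A w u} + card S + 1"
proof -
  have "{w \<in> W. A w u} \<subseteq> {w \<in> I. A w u} \<union> S \<union> {y}"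
    using assms(2,3) PW by (auto simp: K_def)
  then have "card {w \<in> W. A w u} \<le> card ({w \<in> I. A w u} \<union> S \<union> {y})"
    using assms(4,5) by (intro card_mono) auto
  also have "\<dots> \<le> card {w \<in> I. A w u} + card S + 1"
    using card_Un_le[of "{w \<in> I. A w u} \<union> S" "{y}"] card_Un_le[of "{w \<in> I. A w u}" S] by simp
  finally show ?thesis using indeg_ge[OF assms(1)] by simp
qed

lemma out_neighbours_of_K:
  assumes "u \<in> W" "\<And>w. w \<in> K \<Longrightarrow> A u w \<Longrightarrow> w \<in> I" "\<And>w. w \<in> P \<union> {y} \<Longrightarrow> A u w \<Longrightarrow> w \<in> S"
    "finite I" "finite S"
  shows "m \<le> card {w \<in> I. A u w} + card S + 1"
proof -
  have "{w \<in> W. A u w} \<subseteq> {w \<in> I. A u w} \<union> S \<union> {x}"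
    using assms(2,3) PW by (auto simp: K_def)
  then have "card {w \<in> W. A u w} \<le> card ({w \<in> I. A u w} \<union> S \<union> {x})"
    using assms(4,5) by (intro card_mono) auto
  also have "\<dots> \<le> card {w \<in> I. A u w} + card S + 1"
    using card_Un_le[of "{w \<in> I. A u w} \<union> S" "{x}"] card_Un_le[of "{w \<in> I. A u w}" S] by simp
  finally show ?thesis using outdeg_ge[OF assms(1)] by simp
qed

lemma not_P_dominates_K: "\<not> (\<forall>q\<in>P. \<forall>w\<in>K. A q w)"
proof
  assume all: "\<forall>q\<in>P. \<forall>w\<in>K. A q w"
  obtain q where q: "q \<in> P" "card {u \<in> P \<union> {x, y}. A u q} < m" using few_in by (auto simp: P_def)
  have "A w q \<Longrightarrow> w \<notin> K" for w using all q(1) asym[of q w] PW KW by blast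
  then have "{w \<in> W. A w q} \<subseteq> {u \<in> P \<union> {x, y}. A u q}" by (auto simp: K_def)
  then have "card {w \<in> W. A w q} \<le> card {u \<in> P \<union> {x, y}. A u q}" using finP by (intro card_mono) auto
  then show False using q indeg_ge[of q] PW by auto
qed

lemma not_K_dominates_P: "\<not> (\<forall>q\<in>P. \<forall>w\<in>K. A w q)"
proof
  assume all: "\<forall>q\<in>P. \<forall>w\<in>K. A w q"
  obtain q where q: "q \<in> P" "card {u \<in> P \<union> {x, y}. A q u} < m" using few_out by (auto simp: P_def)
  have "A q w \<Longrightarrow> w \<notin> K" for w using all q(1) asym[of w q] PW KW by blast
  then have "{w \<in> W. A q w} \<subseteq> {u \<in> P \<union> {x, y}. A q u}" by (auto simp: K_def)
  then have "card {w \<in> W. A q w} \<le> card {u \<in> P \<union> {x, y}. A q u}" using finP by (intro card_mono) auto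
  then show False using q outdeg_ge[of q] PW by auto
qed

text \<open>If no vertex can be absorbed, \<open>K\<close> splits into the set \<open>R\<close>
  dominated by all route vertices and the set \<open>U\<close> dominating them all, and the degree
  bounds make these too large.\<close>

lemma attains_insert_one:
  assumes "K \<noteq> {}" "3 \<le> card P"
  shows "attains (card P + 1)"
proof (rule ccontr)
  assume no: "\<not> attains (card P + 1)"
  have cross: "\<not> (A q w \<and> A w q')" if "w \<in> K" "q \<in> set P1 \<and> q' \<in> set P2 \<or> q \<in> set P2 \<and> q' \<in> set P1" for q q' w
    using attains_cross[of q q' "[w]"] attains_cross2[of q q' "[w]"] no that by auto
  have dich: "A q w" if "w \<in> K" "q \<in> P" "\<not> A w q" for q w
    using that PW KW by (intro total) (auto simp: K_def)
  have dich': "A w q" if "w \<in> K" "q \<in> P" "\<not> A q w" for q w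
    using that PW KW by (intro total) (auto simp: K_def)
  define R where "R = {w \<in> K. \<forall>q\<in>P. A q w}"
  define U where "U = {w \<in> K. \<forall>q\<in>P. A w q}"
  \<comment> \<open>If \<open>q\<close> dominates \<open>w\<close> and \<open>w\<close> dominates
    \<open>p\<close>, then by \<open>cross\<close> both lie on one route, and either direction
    between \<open>w\<close> and a vertex of the other route violates \<open>cross\<close>.\<close>
  have RU: "w \<in> R \<or> w \<in> U" if w: "w \<in> K" for w
  proof (cases "\<exists>q\<in>P. A q w")
    case True
    then obtain q where q: "q \<in> P" "A q w" by blast
    have "A p w" if "p \<in> P" for p
    proof (rule ccontr)
      assume "\<not> A p w"
      then have pw: "A w p" using dich' w that by blast
      then have same: "q \<in> set P1 \<longleftrightarrow> p \<in> set P1" using cross[of w q p] q w that by (auto simp: P_def)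
      obtain p1 p2 where pp: "p1 \<in> set P1" "p2 \<in> set P2" using nonempty by fastforce
      show False
      proof (cases "q \<in> set P1")
        case True
        then have "\<not> A w p2" "\<not> A p2 w" using cross[of w q p2] cross[of w p2 p] same pp w q pw by auto
        then show False using dich[of w p2] w pp by (auto simp: P_def)
      next
        case False
        then have "q \<in> set P2" "p \<in> set P2" using same q that by (auto simp: P_def)
        then have "\<not> A w p1" "\<not> A p1 w" using cross[of w q p1] cross[of w p1 p] pp w q pw by auto
        then show False using dich[of w p1] w pp by (auto simp: P_def)
      qed
    qed
    then show ?thesis using w by (auto simp: R_def)
  next
    case False
    then show ?thesis using w dich' by (auto simp: U_def)
  qed
  have K_eq: "K = R \<union> U" using RU by (auto simp: R_def U_def)
  obtain p0 where p0: "p0 \<in> P" using nonempty by (auto simp: P_def) (meson list.set_sel(1))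
  have disj: "R \<inter> U = {}" using p0 asym[of p0] PW KW unfolding R_def U_def by blast
  have Ry: "\<not> A w y" if "w \<in> R" for w
    using attains_tail[of p0 "[w]"] no that p0 by (auto simp: R_def)
  have xU: "\<not> A x w" if "w \<in> U" for w
    using attains_head[of p0 "[w]"] no that p0 by (auto simp: U_def)
  have good2: "attains (card P + 1)" if "R' \<subseteq> P" "distinct (Q1 @ Q2)" "set (Q1 @ Q2) = R'" "card R' + 1 = card P"
    "u \<in> R" "v \<in> U" "walk A x (Q1 @ u # v # Q2) y" for R' Q1 Q2 u v
  proof -
    let ?q = "Q1 @ u # v # Q2"
    have uv: "u \<in> K" "v \<in> K" "u \<noteq> v" using that disj by (auto simp: R_def U_def)
    have d: "distinct ?q" "set ?q \<subseteq> W - {x, y}"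
      using that uv PW KW by (auto simp: K_def)
    have "length (Q1 @ Q2) = card R'" using that(2,3) by (metis distinct_card)
    then have "card (set ?q) = card P + 1" using distinct_card[OF d(1)] that(4) by simp
    then show ?thesis unfolding attains_def using d spansI[OF d(1) that(7)] by blast
  qed
  have long: "\<exists>Q1 a b Q2. (P1 = Q1 \<and> P2 = a # b # Q2 \<or> P2 = Q1 \<and> P1 = a # b # Q2)"
  proof -
    have "2 \<le> length P1 \<or> 2 \<le> length P2" using assms(2) cardP by linarith
    then show ?thesis by (auto simp: Suc_le_length_iff numeral_2_eq_2)
  qed
  \<comment> \<open>Such an arc can replace the first vertex \<open>a\<close> of a route with at
    least two vertices: \<open>x, Q1, u, v, b, Q2, y\<close> has one inner vertex more than
    \<open>P\<close> has elements.\<close>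
  have UR: "\<not> A u v" if uv: "u \<in> R" "v \<in> U" for u v
  proof
    assume "A u v"
    from long obtain Q1 a b Q2 where Q: "P1 = Q1 \<and> P2 = a # b # Q2 \<or> P2 = Q1 \<and> P1 = a # b # Q2" by blast
    have r: "walk A x Q1 y" "Q1 \<noteq> []" "walk A b Q2 y" using Q route nonempty by auto
    have "last Q1 \<in> P" "b \<in> P" using Q nonempty unfolding P_def by fastforce+
    then have "A (last Q1) u" "A v b" using uv r(2) by (auto simp: R_def U_def)
    then have "walk A x Q1 u" using r(1,2) by (simp add: walk_iff_successively)
    then have "walk A x (Q1 @ u # v # b # Q2) y" using \<open>A u v\<close> \<open>A v b\<close> r(3) by (simp add: walk_append)
    moreover have "distinct (Q1 @ b # Q2)" "set (Q1 @ b # Q2) \<subseteq> P" using Q dist by (auto simp: P_def)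
    moreover have "card (set (Q1 @ b # Q2)) + 1 = card P"
      using Q cardP distinct_card[OF \<open>distinct (Q1 @ b # Q2)\<close>] by (elim disjE) simp_all
    ultimately show False using good2[of "set (Q1 @ b # Q2)" Q1 "b # Q2" u v] uv no by blast
  qed
  have RsubK: "R \<subseteq> W" "U \<subseteq> W" using KW by (auto simp: R_def U_def)
  have fRU: "finite R" "finite U" using finK by (auto simp: R_def U_def)
  \<comment> \<open>Out-neighbours of a vertex of \<open>R\<close> lie in \<open>R\<close> or equal
    \<open>x\<close>.\<close>
  have "2 * m \<le> card R + 1" if "R \<noteq> {}"
  proof -
    obtain u where u: "u \<in> R" "2 * card {w \<in> R. A u w} + 1 \<le> card R"
      using few_out_neighbours[OF RsubK(1) \<open>R \<noteq> {}\<close>] by blast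
    have "m \<le> card {w \<in> R. A u w} + card ({} :: 'a set) + 1"
    proof (rule out_neighbours_of_K)
      show "u \<in> W" using u RsubK by blast
      show "w \<in> R" if "w \<in> K" "A u w" for w using that UR u K_eq by blast
      show "w \<in> {}" if "w \<in> P \<union> {y}" "A u w" for w
      proof -
        have "w \<in> P \<Longrightarrow> A w u" using u(1) by (simp add: R_def)
        then show ?thesis using that Ry[OF u(1)] asym[OF that(2)] u(1) RsubK PW by auto
      qed
    qed (use fRU in auto)
    then show ?thesis using u by simp
  qed
  moreover have "2 * m \<le> card U + 1" if "U \<noteq> {}"
  proof -
    obtain u where u: "u \<in> U" "2 * card {w \<in> U. A w u} + 1 \<le> card U"
      using few_in_neighbours[OF RsubK(2) \<open>U \<noteq> {}\<close>] by blast
    have "m \<le> card {w \<in> U. A w u} + card ({} :: 'a set) + 1"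
    proof (rule in_neighbours_of_K)
      show "u \<in> W" using u RsubK by blast
      show "w \<in> U" if "w \<in> K" "A w u" for w using that UR u K_eq by blast
      show "w \<in> {}" if "w \<in> P \<union> {x}" "A w u" for w
      proof -
        have "w \<in> P \<Longrightarrow> A u w" using u(1) by (simp add: U_def)
        then show ?thesis using that xU[OF u(1)] asym[OF that(2)] u(1) RsubK PW by auto
      qed
    qed (use fRU in auto)
    then show ?thesis using u by simp
  qed
  moreover have "R \<noteq> {}"
  proof
    assume "R = {}"
    then have "w \<in> U" if "w \<in> K" for w using RU[OF that] by simp
    then have "\<forall>q\<in>P. \<forall>w\<in>K. A w q" unfolding U_def by blast
    then show False using not_K_dominates_P by contradiction
  qed
  moreover have "U \<noteq> {}"
  proof
    assume "U = {}"
    then have "w \<in> R" if "w \<in> K" for w using RU[OF that] by simp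
    then have "\<forall>q\<in>P. \<forall>w\<in>K. A q w" unfolding R_def by blast
    then show False using not_P_dominates_K by contradiction
  qed
  moreover have "card K = card R + card U" using card_Un_disjoint[OF fRU disj] K_eq by argo
  \<comment> \<open>\<open>R\<close> and \<open>U\<close> together have at least
    \<open>4 * m - 2\<close> vertices, but \<open>K\<close> has at most
    \<open>3 * m - 6\<close>.\<close>
  ultimately show False using cardK card_W m_ge by linarith
qed

text \<open>Failing absorption, no path of order \<open>g\<close> leads from \<open>X q\<close> out
  of \<open>X q'\<close> for \<open>q\<close>, \<open>q'\<close> on different routes. By strength
  such sets are both empty, both \<open>K\<close>, or complementary; the first two cases contradict
  the degree bounds.\<close>

lemma attains_insert_strong:
  assumes "strong A K" "2 \<le> g" "g \<le> card K"
  shows "attains (card P + g)"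
proof (rule ccontr)
  assume no: "\<not> attains (card P + g)"
  have ins: "attains (card P + g)" if "gpath A K g ks" "A q (hd ks)" "A (last ks) q'"
    "q \<in> set P1 \<and> q' \<in> set P2 \<or> q \<in> set P2 \<and> q' \<in> set P1" for ks q q'
    using attains_cross[of q q' ks] attains_cross2[of q q' ks] walk_gpath[OF that(1-3)] that(1,4)
    by (auto simp: gpath_def)
  define X where "X q = {w \<in> K. A q w}" for q
  have lastX: "A v q" if "v \<in> K" "v \<notin> X q" "q \<in> P" for v q
    using that PW KW by (intro total) (auto simp: X_def K_def)
  have nox: False if "gpath A K g ks" "hd ks \<in> X q" "last ks \<notin> X q'"
    "q \<in> set P1 \<and> q' \<in> set P2 \<or> q \<in> set P2 \<and> q' \<in> set P1" for ks q q'
  proof -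
    have "last ks \<in> K" using that(1) gpath_ends by blast
    then have "A (last ks) q'" using lastX that by (auto simp: P_def)
    then show False using ins[OF that(1) _ _ that(4)] that(2) no by (auto simp: X_def)
  qed
  have full: "\<exists>ks. gpath A K g ks \<and> hd ks = u" if "u \<in> K" for u
  proof -
    have "\<exists>c\<in>Y. \<exists>d\<in>K - Y. A c d" if "u \<in> Y" "Y \<subset> K" for Y
      using assms(1) that unfolding strong_def by blast
    then show ?thesis using gpath_from[OF KW \<open>u \<in> K\<close>] assms(2,3) by (metis One_nat_def Suc_1 Suc_leD)
  qed
  have full': "\<exists>ks. gpath A K g ks \<and> last ks = u" if "u \<in> K" for u
  proof -
    have "\<exists>c\<in>Y. \<exists>d\<in>K - Y. A d c" if Y: "u \<in> Y" "Y \<subset> K" for Y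
    proof -
      have "K - Y \<subset> K" "K - Y \<noteq> {}" using Y by auto
      then obtain c d where "c \<in> K - Y" "d \<in> K" "d \<notin> K - Y" "A c d" by (rule strongE[OF assms(1)])
      then show ?thesis by blast
    qed
    then show ?thesis using gpath_to[OF KW \<open>u \<in> K\<close>] assms(2,3) by (metis One_nat_def Suc_1 Suc_leD)
  qed
  have XK: "X q \<subseteq> K" for q by (auto simp: X_def)
  have Kne: "K \<noteq> {}" using assms by auto
  have pair: "X q = {} \<and> X q' = {} \<or> X q = K \<and> X q' = K \<or> X q \<noteq> {} \<and> X q \<noteq> K \<and> X q' = K - X q"
    if q: "q \<in> set P1" "q' \<in> set P2" for q q'
  proof -
    \<comment> \<open>A path leaving the intersection starts in both sets and ends outside one; a
      path leaving the union starts in one and ends outside both. Either way \<open>nox\<close>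
      applies across the routes.\<close>
    have triv: "Y = {} \<or> Y = K" if Y: "Y = X q \<inter> X q' \<or> Y = X q \<union> X q'" for Y
    proof (rule ccontr)
      assume n: "\<not> ?thesis"
      then have "Y \<subset> K" "Y \<noteq> {}" using Y XK by blast+
      then obtain ks where ks: "gpath A K g ks" "hd ks \<in> Y" "last ks \<in> K - Y"
        using strong_gpath_leaving[OF KW assms(1) _ _ assms(2,3)] by blast
      show False
        using Y nox[OF ks(1), of q q'] nox[OF ks(1), of q' q] ks(2,3) q by blast
    qed
    have e1: "X q' = {}" if "X q = {}"
    proof (rule ccontr)
      assume "X q' \<noteq> {}"
      then obtain u where "u \<in> X q'" by blast
      moreover from this obtain ks where "gpath A K g ks" "hd ks = u" using full XK by blast
      ultimately show False using nox[of ks q' q] that q by auto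
    qed
    have e2: "X q' = K" if "X q = K"
    proof (rule ccontr)
      assume "X q' \<noteq> K"
      then obtain u where u: "u \<in> K" "u \<notin> X q'" using XK by blast
      then obtain ks where ks: "gpath A K g ks" "last ks = u" using full' by blast
      then have "hd ks \<in> K" using gpath_ends by blast
      then show False using nox[of ks q q'] that q ks u by auto
    qed
    show ?thesis using triv[of "X q \<inter> X q'"] triv[of "X q \<union> X q'"] e1 e2 XK[of q] XK[of q'] by blast
  qed
  obtain p1 p2 where pp: "p1 \<in> set P1" "p2 \<in> set P2" using nonempty by fastforce
  have "\<not> (X p1 = {} \<and> X p2 = {})"
  proof
    assume e: "X p1 = {} \<and> X p2 = {}"
    have "X q = {}" if "q \<in> P" for q
      using that pair[of q p2] pair[of p1 q] pp e Kne XK[of q] unfolding P_def by blast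
    then have "\<forall>q\<in>P. \<forall>w\<in>K. A w q" using lastX by blast
    then show False using not_K_dominates_P by blast
  qed
  moreover have "\<not> (X p1 = K \<and> X p2 = K)"
  proof
    assume e: "X p1 = K \<and> X p2 = K"
    have "X q = K" if "q \<in> P" for q
      using that pair[of q p2] pair[of p1 q] pp e Kne XK[of q] unfolding P_def by blast
    then have "\<forall>q\<in>P. \<forall>w\<in>K. A q w" by (auto simp: X_def)
    then show False using not_P_dominates_K by blast
  qed
  ultimately have mid: "X p1 \<noteq> {}" "X p1 \<noteq> K" "X p2 = K - X p1" using pair[OF pp] by auto
  show False
  proof (cases "2 < card P")
    case True
    \<comment> \<open>All vertices of one route share the same \<open>X\<close>, so a path leaving
      it is a detour between two consecutive vertices of that route.\<close>
    have same1: "X q = X p1" if "q \<in> set P1" for q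
      using pair[OF that pp(2)] mid XK[of q] XK[of p1] by blast
    have same2: "X q = X p2" if "q \<in> set P2" for q
      using pair[OF pp(1) that] mid by blast
    have leave: "\<exists>ks. gpath A K g ks \<and> hd ks \<in> X q \<and> last ks \<in> K - X q" if "q = p1 \<or> q = p2" for q
    proof -
      have "X q \<subset> K" "X q \<noteq> {}" using mid that XK by auto
      then show ?thesis using strong_gpath_leaving[OF KW assms(1) _ _ assms(2,3)] by metis
    qed
    have "2 \<le> length P1 \<or> 2 \<le> length P2" using True cardP by linarith
    then show False
    proof
      assume "2 \<le> length P1"
      then obtain a b L where L: "P1 = [] @ a # [] @ b # L" by (auto simp: Suc_le_length_iff numeral_2_eq_2)
      obtain ks where ks: "gpath A K g ks" "hd ks \<in> X p1" "last ks \<in> K - X p1" using leave by blast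
      have "a \<in> set P1" "b \<in> set P1" using L by auto
      then have ab: "X a = X p1" "X b = X p1" "a \<in> P" "b \<in> P" using same1 by (auto simp: P_def)
      have "A a (hd ks)" "A (last ks) b" using ks ab lastX[of "last ks" b] by (auto simp: X_def)
      then show False using attains_forward[OF L walk_gpath] ks(1) no by (auto simp: gpath_def)
    next
      assume "2 \<le> length P2"
      then obtain a b L where L: "P2 = [] @ a # [] @ b # L" by (auto simp: Suc_le_length_iff numeral_2_eq_2)
      obtain ks where ks: "gpath A K g ks" "hd ks \<in> X p2" "last ks \<in> K - X p2" using leave by blast
      have "a \<in> set P2" "b \<in> set P2" using L by auto
      then have ab: "X a = X p2" "X b = X p2" "a \<in> P" "b \<in> P" using same2 by (auto simp: P_def)
      have "A a (hd ks)" "A (last ks) b" using ks ab lastX[of "last ks" b] by (auto simp: X_def)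
      then show False using attains_forward2[OF L walk_gpath] ks(1) no by (auto simp: gpath_def)
    qed
  next
    case False
    \<comment> \<open>Each route is now a single vertex. A path starting at an out-neighbour of
      \<open>x\<close> ends outside one of the complementary sets \<open>X p1\<close> and
      \<open>X p2\<close>, so it joins \<open>x\<close> to \<open>p1\<close> or
      \<open>p2\<close>.\<close>
    have "\<exists>u\<in>K. A x u"
    proof (rule ccontr)
      assume "\<not> ?thesis"
      then have "{w \<in> W. A x w} \<subseteq> P \<union> {y}" using irrefl by (auto simp: K_def)
      then have "card {w \<in> W. A x w} \<le> card (P \<union> {y})" using finP by (intro card_mono) auto
      also have "\<dots> \<le> 3" using False card_Un_le[of P "{y}"] by simp
      finally show False using outdeg_ge[OF xW] m_ge by simp
    qed
    then obtain u where u: "u \<in> K" "A x u" by blast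
    then obtain ks where ks: "gpath A K g ks" "hd ks = u" using full by blast
    have l: "last ks \<in> K" using ks(1) gpath_ends by blast
    obtain q where q: "q \<in> P" "last ks \<notin> X q" using mid pp l by (cases "last ks \<in> X p1") (auto simp: P_def)
    then have "A (last ks) q" using lastX l by blast
    then show False using attains_head[OF q(1) walk_gpath] ks u no by (auto simp: gpath_def)
  qed
qed

text \<open>\<open>Src\<close> sends arcs to the initial component \<open>I\<close>, and
  \<open>Snk\<close> receives arcs from the terminal component \<open>J\<close>. Failing absorption
  puts both on one route with \<open>Snk\<close> weakly before \<open>Src\<close>; so few arcs enter
  \<open>I\<close> or leave \<open>J\<close>, and the two components become too large.\<close>

lemma attains_insert_not_strong:
  assumes "\<not> strong A K" "2 \<le> g" "g \<le> card K"
  shows "attains (card P + g)"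
proof (rule ccontr)
  assume no: "\<not> attains (card P + g)"
  obtain I J where IJ: "I \<noteq> {}" "J \<noteq> {}" "I \<subseteq> K" "J \<subseteq> K" "I \<inter> J = {}"
    and dom: "\<forall>u\<in>I. \<forall>w\<in>K - I. A u w" "\<forall>v\<in>J. \<forall>w\<in>K - J. A w v"
    and paths: "\<forall>u\<in>I. \<forall>v\<in>J. \<forall>g. 2 \<le> g \<longrightarrow> g \<le> card K \<longrightarrow> (\<exists>ks. gpath A K g ks \<and> hd ks = u \<and> last ks = v)"
    by (rule not_strong_decomposition[OF KW assms(1)])
  define Src where "Src = {q \<in> P \<union> {x}. \<exists>u\<in>I. A q u}"
  define Snk where "Snk = {q \<in> P \<union> {y}. \<exists>v\<in>J. A v q}"
  have link: "\<exists>ks. walk A q ks q' \<and> set ks \<subseteq> K \<and> distinct ks \<and> length ks = g"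
    if qq: "q \<in> Src" "q' \<in> Snk" for q q'
  proof -
    obtain u v where uv: "u \<in> I" "A q u" "v \<in> J" "A v q'" using qq by (auto simp: Src_def Snk_def)
    then obtain ks where "gpath A K g ks" "hd ks = u" "last ks = v" using paths assms(2,3) by blast
    then show ?thesis using walk_gpath uv by (auto simp: gpath_def)
  qed
  have x_Src: False if "x \<in> Src" "q' \<in> Snk" for q'
    using link[OF that] attains_head[of q'] attains_xy no that(2) by (auto simp: Snk_def)
  have y_Snk: False if "q \<in> Src" "y \<in> Snk" for q
    using link[OF that] attains_tail[of q] attains_xy no that(1) by (auto simp: Src_def)
  have crs: False if "q \<in> Src" "q' \<in> Snk" "q \<in> set P1 \<and> q' \<in> set P2 \<or> q \<in> set P2 \<and> q' \<in> set P1" for q q'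
    using link[OF that(1,2)] attains_cross[of q q'] attains_cross2[of q q'] no that(3) by blast
  have fwd1: False if "P1 = L1 @ q # L2 @ q' # L3" "q \<in> Src" "q' \<in> Snk" for q q' L1 L2 L3
    using link[OF that(2,3)] attains_forward[OF that(1)] no by blast
  have fwd2: False if "P2 = L1 @ q # L2 @ q' # L3" "q \<in> Src" "q' \<in> Snk" for q q' L1 L2 L3
    using link[OF that(2,3)] attains_forward2[OF that(1)] no by blast
  have fin': "finite Src" "finite Snk" "finite I" "finite J"
    using finP finK IJ by (auto simp: Src_def Snk_def intro: finite_subset)
  have IJW: "I \<subseteq> W" "J \<subseteq> W" using IJ KW by auto
  \<comment> \<open>In-neighbours of a vertex of \<open>I\<close> lie in \<open>I\<close> or
    \<open>Src\<close> or equal \<open>y\<close>.\<close>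
  have cI: "2 * m \<le> card I + 1 + 2 * card Src"
  proof -
    obtain u where u: "u \<in> I" "2 * card {w \<in> I. A w u} + 1 \<le> card I"
      using few_in_neighbours[OF IJW(1) IJ(1)] by blast
    have "m \<le> card {w \<in> I. A w u} + card Src + 1"
    proof (rule in_neighbours_of_K)
      show "u \<in> W" using u IJW by blast
      show "w \<in> I" if "w \<in> K" "A w u" for w using that dom(1) u asym[of u w] KW IJ by blast
      show "w \<in> Src" if "w \<in> P \<union> {x}" "A w u" for w using that u by (auto simp: Src_def)
    qed (use fin' in auto)
    then show ?thesis using u by simp
  qed
  have cJ: "2 * m \<le> card J + 1 + 2 * card Snk"
  proof -
    obtain u where u: "u \<in> J" "2 * card {w \<in> J. A u w} + 1 \<le> card J"
      using few_out_neighbours[OF IJW(2) IJ(2)] by blast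
    have "m \<le> card {w \<in> J. A u w} + card Snk + 1"
    proof (rule out_neighbours_of_K)
      show "u \<in> W" using u IJW by blast
      show "w \<in> J" if "w \<in> K" "A u w" for w using that dom(2) u asym[of w u] KW IJ by blast
      show "w \<in> Snk" if "w \<in> P \<union> {y}" "A u w" for w using that u by (auto simp: Snk_def)
    qed (use fin' in auto)
    then show ?thesis using u by simp
  qed
  have "card I + card J = card (I \<union> J)" using IJ(5) fin' by (simp add: card_Un_disjoint)
  also have "\<dots> \<le> card K" using IJ finK by (intro card_mono) auto
  finally have IJK: "card I + card J \<le> card K" .
  have pos: "card I \<ge> 1" "card J \<ge> 1" using fin' IJ by (auto simp: Suc_le_eq card_gt_0_iff)
  have "card Src \<le> card (P \<union> {x})" "card Snk \<le> card (P \<union> {y})"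
    using finP by (auto simp: Src_def Snk_def intro!: card_mono)
  then have le: "card Src \<le> card P + 1" "card Snk \<le> card P + 1"
    using card_Un_le[of P "{x}"] card_Un_le[of P "{y}"] by simp_all
  have ne: "Src \<noteq> {}" "Snk \<noteq> {}"
  proof -
    \<comment> \<open>Were \<open>Src\<close> empty, \<open>I\<close> would have at least
      \<open>2 * m - 1\<close> vertices, leaving too little of \<open>K\<close> for
      \<open>cJ\<close> even with \<open>Snk\<close> as large as possible.\<close>
    have "card Src \<noteq> 0" using cI cJ IJK pos le cardK card_W by linarith
    then show "Src \<noteq> {}" by auto
    have "card Snk \<noteq> 0" using cI cJ IJK pos le cardK card_W by linarith
    then show "Snk \<noteq> {}" by auto
  qed
  then have "Src \<subseteq> P" "Snk \<subseteq> P" using x_Src y_Snk unfolding Src_def Snk_def by blast+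
  then have "Src \<subseteq> set P1 \<and> Snk \<subseteq> set P1 \<or> Src \<subseteq> set P2 \<and> Snk \<subseteq> set P2"
    using crs ne unfolding P_def by blast
  then have sum: "card Src + card Snk \<le> length P1 + 1 \<or> card Src + card Snk \<le> length P2 + 1"
  proof
    assume "Src \<subseteq> set P1 \<and> Snk \<subseteq> set P1"
    then have "card Src + card Snk \<le> length P1 + 1"
      by (intro card_ordered_pair_le[OF dist(1)]) (auto dest: fwd1)
    then show ?thesis ..
  next
    assume "Src \<subseteq> set P2 \<and> Snk \<subseteq> set P2"
    then have "card Src + card Snk \<le> length P2 + 1"
      by (intro card_ordered_pair_le[OF dist(2)]) (auto dest: fwd2)
    then show ?thesis ..
  qed
  have "length P1 \<ge> 1" "length P2 \<ge> 1" using nonempty by (auto simp: Suc_le_eq)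
  \<comment> \<open>If the route carrying both sets has \<open>l\<close> vertices, then
    \<open>card P \<ge> l + 1\<close> and the bounds give \<open>m \<le> l\<close>, against
    \<open>l \<le> 3 < m\<close>.\<close>
  with sum show False
    by (elim disjE) (use cI cJ IJK cardK card_W m_ge cardP short in linarith)+
qed

theorem attains_all:
  assumes "card P \<le> r" "r + 2 \<le> card W" "r = card P + 1 \<Longrightarrow> 3 \<le> card P"
  shows "attains r"
proof -
  obtain g where g: "r = card P + g" using assms(1) le_Suc_ex by blast
  then have "g \<le> card K" using assms(2) cardK by linarith
  consider "g = 0" | "g = 1" | "2 \<le> g" by linarith
  then show ?thesis
  proof cases
    case 1
    then show ?thesis using g attains_P by simp
  next
    case 2
    then show ?thesis using g attains_insert_one assms(3) \<open>g \<le> card K\<close> by force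
  next
    case 3
    then show ?thesis
      using g attains_insert_strong attains_insert_not_strong \<open>g \<le> card K\<close> by blast
  qed
qed

end

section \<open>Finding two short routes\<close>

context terminals
begin

definition "Sx = {w \<in> W - {x, y}. A x w}"
definition "Ty = {w \<in> W - {x, y}. A w y}"

lemma nbrs_sub: "Sx \<subseteq> W - {x, y}" "Ty \<subseteq> W - {x, y}" by (auto simp: Sx_def Ty_def)

lemma fin_nbrs: "finite Sx" "finite Ty" using nbrs_sub fin finite_subset by blast+

lemma card_nbrs: "m \<le> card Sx + 1" "m \<le> card Ty + 1"
proof -
  have "{w \<in> W. A x w} \<subseteq> insert y Sx" "{w \<in> W. A w y} \<subseteq> insert x Ty"
    using irrefl by (auto simp: Sx_def Ty_def)
  then have "card {w \<in> W. A x w} \<le> card (insert y Sx)" "card {w \<in> W. A w y} \<le> card (insert x Ty)"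
    using fin_nbrs by (auto intro: card_mono)
  then show "m \<le> card Sx + 1" "m \<le> card Ty + 1"
    using outdeg_ge[OF xW] indeg_ge[OF yW] fin_nbrs by (auto simp: card_insert_if split: if_splits)
qed

lemma card_inner: "card (W - {x, y}) + 2 = card W"
proof -
  have "card {x, y} \<le> card W" using xW yW fin by (intro card_mono) auto
  then show ?thesis using xW yW xy fin by (simp add: card_Diff_subset)
qed

lemma not_to_x: "a \<in> Sx \<Longrightarrow> \<not> A a x" and not_from_y: "b \<in> Ty \<Longrightarrow> \<not> A y b"
  using asym[of x a] asym[of b y] xW yW by (auto simp: Sx_def Ty_def)

lemma not_to_y: "w \<in> W - {x, y} \<Longrightarrow> w \<notin> Ty \<Longrightarrow> \<not> A w y"
  and not_from_x: "w \<in> W - {x, y} \<Longrightarrow> w \<notin> Sx \<Longrightarrow> \<not> A x w"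
  by (auto simp: Sx_def Ty_def)

text \<open>If no path \<open>x, a, w, b, y\<close> exists, every inner vertex lies in
  \<open>D1\<close> or \<open>D2\<close>, so the complements of these sets are disjoint; the degree
  bounds make them too large.\<close>

lemma attains_three: "attains 3"
proof (rule ccontr)
  assume no: "\<not> attains 3"
  let ?D = "W - {x, y}"
  define D1 where "D1 = {w \<in> ?D. \<forall>a\<in>Sx. \<not> A a w}"
  define D2 where "D2 = {w \<in> ?D. \<forall>b\<in>Ty. \<not> A w b}"
  have cov: "w \<in> D1 \<or> w \<in> D2" if wD: "w \<in> ?D" for w
  proof (rule ccontr)
    assume "\<not> ?thesis"
    then obtain a b where ab: "a \<in> Sx" "A a w" "b \<in> Ty" "A w b" using wD unfolding D1_def D2_def by blast
    have "a \<noteq> w" "w \<noteq> b" "a \<noteq> b" using ab irrefl asym[OF ab(2)] nbrs_sub wD by blast+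
    then show False using attains_list[of "[a, w, b]" 3] ab wD no by (auto simp: Sx_def Ty_def)
  qed
  have finD: "finite ?D" using fin by simp
  have fD: "finite D1" "finite D2" using finD by (auto simp: D1_def D2_def)
  \<comment> \<open>Two vertices of \<open>Sx\<close> in \<open>D1\<close> would be joined by an
    arc, whose head is then not in \<open>D1\<close>.\<close>
  have c1: "card (Sx \<inter> D1) \<le> 1"
  proof -
    have "a = b" if "a \<in> Sx \<inter> D1" "b \<in> Sx \<inter> D1" for a b
      using that total[of a b] nbrs_sub by (auto simp: D1_def)
    then show ?thesis using fD by (simp add: card_le_Suc0_iff_eq)
  qed
  have c2: "card (Ty \<inter> D2) \<le> 1"
  proof -
    have "a = b" if "a \<in> Ty \<inter> D2" "b \<in> Ty \<inter> D2" for a b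
      using that total[of a b] nbrs_sub by (auto simp: D2_def)
    then show ?thesis using fD by (simp add: card_le_Suc0_iff_eq)
  qed
  \<comment> \<open>A vertex of \<open>Sx\<close> outside \<open>S'\<close> lies in
    \<open>D1\<close>, or in \<open>Ty\<close> and hence in \<open>Ty \<inter> D2\<close>; so at
    most two are lost. A vertex of \<open>S'\<close> sends no arc to \<open>x\<close>,
    \<open>y\<close> or \<open>D1\<close>.\<close>
  define S' where "S' = Sx - D1 - Ty"
  define T' where "T' = Ty - D2 - Sx"
  have f': "finite S'" "finite T'" using fin_nbrs by (auto simp: S'_def T'_def)
  have "card Sx \<le> card (S' \<union> (Sx \<inter> D1) \<union> (Ty \<inter> D2))"
    using f' fD cov nbrs_sub by (intro card_mono) (auto simp: S'_def)
  then have s': "m \<le> card S' + 3"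
    using card_Un_le[of "S' \<union> (Sx \<inter> D1)" "Ty \<inter> D2"] card_Un_le[of S' "Sx \<inter> D1"] c1 c2 card_nbrs by linarith
  have "card Ty \<le> card (T' \<union> (Ty \<inter> D2) \<union> (Sx \<inter> D1))"
    using f' fD cov nbrs_sub by (intro card_mono) (auto simp: T'_def)
  then have t': "m \<le> card T' + 3"
    using card_Un_le[of "T' \<union> (Ty \<inter> D2)" "Sx \<inter> D1"] card_Un_le[of T' "Ty \<inter> D2"] c1 c2 card_nbrs by linarith
  have ne: "S' \<noteq> {}" "T' \<noteq> {}" using s' t' m_ge by auto
  have subW: "S' \<subseteq> W" "T' \<subseteq> W" using nbrs_sub by (auto simp: S'_def T'_def)
  have subD: "S' \<subseteq> ?D - D1" "T' \<subseteq> ?D - D2" using nbrs_sub by (auto simp: S'_def T'_def)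
  obtain a where a: "a \<in> S'" "2 * card {w \<in> S'. A a w} + 1 \<le> card S'"
    using few_out_neighbours[OF subW(1) ne(1)] by blast
  obtain b where b: "b \<in> T'" "2 * card {w \<in> T'. A w b} + 1 \<le> card T'"
    using few_in_neighbours[OF subW(2) ne(2)] by blast
  have "{w \<in> W. A a w} \<subseteq> {w \<in> S'. A a w} \<union> (?D - D1 - S')"
    using a(1) not_to_x[of a] not_to_y[of a] nbrs_sub by (auto simp: S'_def D1_def)
  then have "card {w \<in> W. A a w} \<le> card ({w \<in> S'. A a w} \<union> (?D - D1 - S'))"
    using finD f' by (intro card_mono) auto
  also have "\<dots> \<le> card {w \<in> S'. A a w} + card (?D - D1 - S')" by (rule card_Un_le)
  finally have 1: "m \<le> card {w \<in> S'. A a w} + card (?D - D1 - S')" using outdeg_ge[of a] a(1) subW by force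
  have "{w \<in> W. A w b} \<subseteq> {w \<in> T'. A w b} \<union> (?D - D2 - T')"
    using b(1) not_from_y[of b] not_from_x[of b] nbrs_sub by (auto simp: T'_def D2_def)
  then have "card {w \<in> W. A w b} \<le> card ({w \<in> T'. A w b} \<union> (?D - D2 - T'))"
    using finD f' by (intro card_mono) auto
  also have "\<dots> \<le> card {w \<in> T'. A w b} + card (?D - D2 - T')" by (rule card_Un_le)
  finally have 2: "m \<le> card {w \<in> T'. A w b} + card (?D - D2 - T')" using indeg_ge[of b] b(1) subW by force
  have 3: "card (?D - D1 - S') + card S' = card (?D - D1)" "card (?D - D2 - T') + card T' = card (?D - D2)"
    using subD f' finD card_mono[of "?D - D1" S'] card_mono[of "?D - D2" T'] by (simp_all add: card_Diff_subset)
  have "card (?D - D1) + card (?D - D2) = card ((?D - D1) \<union> (?D - D2))"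
    using finD cov by (intro card_Un_disjoint[symmetric]) auto
  also have "\<dots> \<le> card ?D" using finD by (intro card_mono) auto
  \<comment> \<open>The two disjoint complements would have at least \<open>3 * m - 2\<close>
    vertices, but \<open>?D\<close> has at most \<open>3 * m - 3\<close>.\<close>
  finally show False using 1 2 3 a(2) b(2) s' t' card_inner card_W m_ge by linarith
qed

text \<open>This is the case where one vertex \<open>v\<close> meets every short route.
  Out-neighbours of \<open>a\<close> lie in \<open>S'\<close> or \<open>Q\<close> and in-neighbours
  of \<open>b\<close> in \<open>T'\<close> or \<open>Q\<close>, so inclusion-exclusion yields common
  middle vertices \<open>M a b\<close>.\<close>

lemma attains_separated:
  assumes S': "S' = Sx - {v}" and T': "T' = Ty - {v}" and disj: "S' \<inter> T' = {}"
    and sep: "\<And>a b. a \<in> S' \<Longrightarrow> b \<in> T' \<Longrightarrow> \<not> A a b"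
    and r: "3 \<le> r" "r + 2 \<le> card W"
  shows "attains r"
proof -
  define Q where "Q = W - {x, y} - S' - T'"
  have sub: "S' \<subseteq> W - {x, y}" "T' \<subseteq> W - {x, y}" using nbrs_sub S' T' by auto
  have f: "finite S'" "finite T'" "finite Q" using fin_nbrs fin S' T' by (auto simp: Q_def)
  have c: "m \<le> card S' + 2" "m \<le> card T' + 2"
    using card_nbrs fin_nbrs by (auto simp: S' T' card_Diff_singleton_if)
  have "W - {x, y} = S' \<union> T' \<union> Q" using sub by (auto simp: Q_def)
  moreover have "card (S' \<union> T' \<union> Q) = card S' + card T' + card Q"
    using f disj by (subst card_Un_disjoint; auto simp: Q_def card_Un_disjoint)+
  ultimately have cQ: "card S' + card T' + card Q + 2 = card W" using card_inner by simp
  define M where "M a b = {w \<in> Q. A a w \<and> A w b}" for a b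
  have mid: "2 * m \<le> card {w \<in> S'. A a w} + card {w \<in> T'. A w b} + card Q + card (M a b)"
    if ab: "a \<in> S'" "b \<in> T'" for a b
  proof -
    have "{w \<in> W. A a w} \<subseteq> {w \<in> S'. A a w} \<union> {w \<in> Q. A a w}"
      using ab not_to_x[of a] not_to_y[of a] sub sep[of a] disj by (auto simp: Q_def S' T')
    then have "card {w \<in> W. A a w} \<le> card ({w \<in> S'. A a w} \<union> {w \<in> Q. A a w})"
      using f by (intro card_mono) auto
    then have 1: "m \<le> card {w \<in> S'. A a w} + card {w \<in> Q. A a w}"
      using outdeg_ge[of a] card_Un_le[of "{w \<in> S'. A a w}" "{w \<in> Q. A a w}"] ab sub by fastforce
    have "{w \<in> W. A w b} \<subseteq> {w \<in> T'. A w b} \<union> {w \<in> Q. A w b}"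
      using ab not_from_x[of b] not_from_y[of b] sub sep[of _ b] disj by (auto simp: Q_def S' T')
    then have "card {w \<in> W. A w b} \<le> card ({w \<in> T'. A w b} \<union> {w \<in> Q. A w b})"
      using f by (intro card_mono) auto
    then have 2: "m \<le> card {w \<in> T'. A w b} + card {w \<in> Q. A w b}"
      using indeg_ge[of b] card_Un_le[of "{w \<in> T'. A w b}" "{w \<in> Q. A w b}"] ab sub by fastforce
    have "M a b = {w \<in> Q. A a w} \<inter> {w \<in> Q. A w b}" by (auto simp: M_def)
    then have "card {w \<in> Q. A a w} + card {w \<in> Q. A w b} = card ({w \<in> Q. A a w} \<union> {w \<in> Q. A w b}) + card (M a b)"
      using card_Un_Int[of "{w \<in> Q. A a w}" "{w \<in> Q. A w b}"] f by simp
    moreover have "card ({w \<in> Q. A a w} \<union> {w \<in> Q. A w b}) \<le> card Q" using f by (intro card_mono) auto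
    ultimately show ?thesis using 1 2 by linarith
  qed
  have ne: "S' \<noteq> {}" "T' \<noteq> {}" using c m_ge by auto
  have W': "S' \<subseteq> W" "T' \<subseteq> W" using sub by auto
  obtain a where a: "a \<in> S'" "2 * card {w \<in> S'. A a w} + 1 \<le> card S'"
    using few_out_neighbours[OF W'(1) ne(1)] by blast
  obtain b where b: "b \<in> T'" "2 * card {w \<in> T'. A w b} + 1 \<le> card T'"
    using few_in_neighbours[OF W'(2) ne(2)] by blast
  have M2: "2 \<le> card (M a b)" using mid[OF a(1) b(1)] a(2) b(2) c cQ card_W by linarith
  have ne': "S' - {a} \<noteq> {}" "T' - {b} \<noteq> {}"
  proof -
    have "card (S' - {a}) > 0" "card (T' - {b}) > 0" using a(1) b(1) c m_ge f by auto
    then show "S' - {a} \<noteq> {}" "T' - {b} \<noteq> {}" by (metis card.empty less_irrefl)+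
  qed
  obtain a' where a': "a' \<in> S' - {a}" "2 * card {w \<in> S' - {a}. A a' w} + 1 \<le> card (S' - {a})"
    using few_out_neighbours[OF _ ne'(1)] W' by blast
  obtain b' where b': "b' \<in> T' - {b}" "2 * card {w \<in> T' - {b}. A w b'} + 1 \<le> card (T' - {b})"
    using few_in_neighbours[OF _ ne'(2)] W' by blast
  have "card {w \<in> S'. A a' w} \<le> card (insert a {w \<in> S' - {a}. A a' w})" using f by (intro card_mono) auto
  then have oa: "2 * card {w \<in> S'. A a' w} \<le> card S'"
    using a' a(1) f by (simp add: card_insert_if card_Diff_singleton_if split: if_splits)
  have "card {w \<in> T'. A w b'} \<le> card (insert b {w \<in> T' - {b}. A w b'})" using f by (intro card_mono) auto
  then have ib: "2 * card {w \<in> T'. A w b'} \<le> card T'"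
    using b' b(1) f by (simp add: card_insert_if card_Diff_singleton_if split: if_splits)
  \<comment> \<open>The second pair has slightly weaker degree bounds and is guaranteed one middle
    vertex instead of two. Choosing \<open>o2\<close> first still leaves an \<open>o1\<close>
    different from it.\<close>
  have "1 \<le> card (M a' b')" using mid[of a' b'] a'(1) b'(1) oa ib c cQ card_W by force
  then obtain o2 where o2: "o2 \<in> M a' b'" by fastforce
  have "\<not> M a b \<subseteq> {o2}" using M2 card_mono[of "{o2}" "M a b"] by auto
  then obtain o1 where o1: "o1 \<in> M a b" "o1 \<noteq> o2" by blast
  have arcs: "A x a" "A a o1" "A o1 b" "A b y" "A x a'" "A a' o2" "A o2 b'" "A b' y"
    using o1 o2 a a' b b' by (auto simp: M_def S' T' Sx_def Ty_def)
  have inQ: "o1 \<in> Q" "o2 \<in> Q" using o1 o2 by (auto simp: M_def)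
  have inD: "a \<in> W - {x, y}" "b \<in> W - {x, y}" "o1 \<in> W - {x, y}" "a' \<in> W - {x, y}" "b' \<in> W - {x, y}" "o2 \<in> W - {x, y}"
    using a b a' b' sub inQ by (auto simp: Q_def)
  have diff: "distinct [a, o1, b, a', o2, b']"
    using a b a' b' inQ o1(2) disj by (auto simp: Q_def)
  \<comment> \<open>\<open>a1\<close> in front and \<open>b1\<close> behind extend
    \<open>a, o1, b\<close> to four and five inner vertices, values of \<open>r\<close> below the
    six of the two routes.\<close>
  obtain a1 where a1: "a1 \<in> S'" "a1 \<noteq> a" "A a1 a"
  proof -
    have "\<not> S' - {a} \<subseteq> {w \<in> S'. A a w}"
    proof
      assume "S' - {a} \<subseteq> {w \<in> S'. A a w}"
      then have "card (S' - {a}) \<le> card {w \<in> S'. A a w}" using f by (intro card_mono) auto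
      then show False using a c m_ge f by simp
    qed
    then obtain w where "w \<in> S'" "w \<noteq> a" "\<not> A a w" by blast
    then show ?thesis using that total[of w a] W' a(1) by blast
  qed
  obtain b1 where b1: "b1 \<in> T'" "b1 \<noteq> b" "A b b1"
  proof -
    have "\<not> T' - {b} \<subseteq> {w \<in> T'. A w b}"
    proof
      assume "T' - {b} \<subseteq> {w \<in> T'. A w b}"
      then have "card (T' - {b}) \<le> card {w \<in> T'. A w b}" using f by (intro card_mono) auto
      then show False using b c m_ge f by simp
    qed
    then obtain w where "w \<in> T'" "w \<noteq> b" "\<not> A w b" by blast
    then show ?thesis using that total[of b w] W' b(1) by blast
  qed
  have ends: "A x a1" "A b1 y" "a1 \<in> W - {x, y}" "b1 \<in> W - {x, y}"
    using a1 b1 sub by (auto simp: S' T' Sx_def Ty_def)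
  have diff1: "distinct [a1, a, o1, b, b1]"
    using a(1) b(1) a1 b1 inQ(1) disj by (auto simp: Q_def)
  consider "r = 3" | "r = 4" | "r = 5" | "6 \<le> r" using r by linarith
  then show ?thesis
  proof cases
    case 1
    then show ?thesis using attains_three by simp
  next
    case 2
    then show ?thesis using attains_list[of "[a1, a, o1, b]" r] arcs ends a1 inD diff1 by auto
  next
    case 3
    then show ?thesis using attains_list[of "[a1, a, o1, b, b1]" r] arcs ends a1 b1 inD diff1 by auto
  next
    case 4
    let ?P = "set [a, o1, b] \<union> set [a', o2, b']"
    \<comment> \<open>By \<open>sep\<close> nothing in \<open>S'\<close> dominates \<open>b\<close>;
      three candidates remain, fewer than \<open>m\<close>.\<close>
    have "{u \<in> ?P \<union> {x, y}. A u b} \<subseteq> {o1, o2, b'}"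
      using sep a b a' irrefl not_from_y[of b] not_from_x[of b] inD disj by (auto simp: S' T')
    then have "card {u \<in> ?P \<union> {x, y}. A u b} \<le> card {o1, o2, b'}" by (intro card_mono) auto
    also have "\<dots> < m" using m_ge by (auto simp: card_insert_if)
    finally have fi: "card {u \<in> ?P \<union> {x, y}. A u b} < m" .
    have "{u \<in> ?P \<union> {x, y}. A a u} \<subseteq> {o1, o2, a'}"
      using sep a b b' irrefl not_to_y[of a] not_to_x[of a] inD disj by (auto simp: S' T')
    then have "card {u \<in> ?P \<union> {x, y}. A a u} \<le> card {o1, o2, a'}" by (intro card_mono) auto
    also have "\<dots> < m" using m_ge by (auto simp: card_insert_if)
    finally have fo: "card {u \<in> ?P \<union> {x, y}. A a u} < m" .
    have tr: "two_routes W A x y m [a, o1, b] [a', o2, b']"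
    proof unfold_locales
      show "\<exists>q\<in>?P. card {u \<in> ?P \<union> {x, y}. A u q} < m" using fi by (intro bexI[of _ b]) auto
      show "\<exists>q\<in>?P. card {u \<in> ?P \<union> {x, y}. A q u} < m" using fo by (intro bexI[of _ a]) auto
    qed (use arcs inD diff in auto)
    then show ?thesis using two_routes.attains_all[OF tr, of r] two_routes.cardP[OF tr] 4 r by simp
  qed
qed

lemma attains_routes:
  assumes "two_routes W A x y m P1 P2" "length P1 + length P2 = t" "t \<le> r" "r + 2 \<le> card W"
    "r = t + 1 \<Longrightarrow> 3 \<le> t"
  shows "attains r"
  using two_routes.attains_all[OF assms(1), of r] two_routes.cardP[OF assms(1)] assms(2-5) by simp

lemma attains_vertex_and_arc:
  assumes "z \<in> Sx \<inter> Ty" "a \<in> Sx" "b \<in> Ty" "A a b" "a \<noteq> z" "b \<noteq> z" "4 \<le> r" "r + 2 \<le> card W"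
  shows "attains r"
proof -
  let ?P = "set [z] \<union> set [a, b]"
  have D: "z \<in> W - {x, y}" "a \<in> W - {x, y}" "b \<in> W - {x, y}" using assms nbrs_sub by auto
  have "a \<noteq> b" using assms irrefl by auto
  have "card {u \<in> ?P \<union> {x, y}. A u z} \<le> card {x, a, b}"
    using not_from_y[of z] assms irrefl by (intro card_mono) auto
  also have "\<dots> < m" using m_ge by (auto simp: card_insert_if)
  finally have fi: "card {u \<in> ?P \<union> {x, y}. A u z} < m" .
  have "card {u \<in> ?P \<union> {x, y}. A z u} \<le> card {y, a, b}"
    using not_to_x[of z] assms irrefl by (intro card_mono) auto
  also have "\<dots> < m" using m_ge by (auto simp: card_insert_if)
  finally have fo: "card {u \<in> ?P \<union> {x, y}. A z u} < m" .
  have "two_routes W A x y m [z] [a, b]"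
  proof unfold_locales
    show "\<exists>q\<in>?P. card {u \<in> ?P \<union> {x, y}. A u q} < m" using fi by (intro bexI[of _ z]) auto
    show "\<exists>q\<in>?P. card {u \<in> ?P \<union> {x, y}. A q u} < m" using fo by (intro bexI[of _ z]) auto
  qed (use assms D \<open>a \<noteq> b\<close> in \<open>auto simp: Sx_def Ty_def\<close>)
  then show ?thesis using assms by (intro attains_routes[of "[z]" "[a, b]" 3]) auto
qed

text \<open>With two route vertices, \<open>r = 3\<close> would mean absorbing a single vertex, a
  case that \<open>attains_all\<close> leaves out; hence \<open>4 \<le> r\<close>.\<close>

lemma attains_two_vertices:
  assumes "z \<in> Sx \<inter> Ty" "z' \<in> Sx \<inter> Ty" "z \<noteq> z'" "4 \<le> r" "r + 2 \<le> card W"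
  shows "attains r"
proof -
  let ?P = "set [z] \<union> set [z']"
  have D: "z \<in> W - {x, y}" "z' \<in> W - {x, y}" using assms nbrs_sub by auto
  have "card {u \<in> ?P \<union> {x, y}. A u z} \<le> card {x, z'}"
    using not_from_y[of z] assms irrefl by (intro card_mono) auto
  also have "\<dots> < m" using m_ge by (auto simp: card_insert_if)
  finally have fi: "card {u \<in> ?P \<union> {x, y}. A u z} < m" .
  have "card {u \<in> ?P \<union> {x, y}. A z u} \<le> card {y, z'}"
    using not_to_x[of z] assms irrefl by (intro card_mono) auto
  also have "\<dots> < m" using m_ge by (auto simp: card_insert_if)
  finally have fo: "card {u \<in> ?P \<union> {x, y}. A z u} < m" .
  have "two_routes W A x y m [z] [z']"
  proof unfold_locales
    show "\<exists>q\<in>?P. card {u \<in> ?P \<union> {x, y}. A u q} < m" using fi by (intro bexI[of _ z]) auto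
    show "\<exists>q\<in>?P. card {u \<in> ?P \<union> {x, y}. A q u} < m" using fo by (intro bexI[of _ z]) auto
  qed (use assms D in \<open>auto simp: Sx_def Ty_def\<close>)
  then show ?thesis using assms by (intro attains_routes[of "[z]" "[z']" 2]) auto
qed

lemma attains_two_arcs:
  assumes "Sx \<inter> Ty = {}" "a \<in> Sx" "b \<in> Ty" "A a b" "a' \<in> Sx" "b' \<in> Ty" "A a' b'" "a \<noteq> a'" "b \<noteq> b'"
    "4 \<le> r" "r + 2 \<le> card W"
  shows "attains r"
proof -
  let ?P = "set [a, b] \<union> set [a', b']"
  have D: "a \<in> W - {x, y}" "b \<in> W - {x, y}" "a' \<in> W - {x, y}" "b' \<in> W - {x, y}" using assms nbrs_sub by auto
  have d: "distinct [a, b, a', b']" using assms by auto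
  have "card {u \<in> ?P \<union> {x, y}. A u b} \<le> card {a, a', b'}"
    using not_from_y[of b] not_from_x[of b] assms D irrefl by (intro card_mono) auto
  also have "\<dots> < m" using m_ge by (auto simp: card_insert_if)
  finally have fi: "card {u \<in> ?P \<union> {x, y}. A u b} < m" .
  have "card {u \<in> ?P \<union> {x, y}. A a u} \<le> card {b, a', b'}"
    using not_to_x[of a] not_to_y[of a] assms D irrefl by (intro card_mono) auto
  also have "\<dots> < m" using m_ge by (auto simp: card_insert_if)
  finally have fo: "card {u \<in> ?P \<union> {x, y}. A a u} < m" .
  have "two_routes W A x y m [a, b] [a', b']"
  proof unfold_locales
    show "\<exists>q\<in>?P. card {u \<in> ?P \<union> {x, y}. A u q} < m" using fi by (intro bexI[of _ b]) auto
    show "\<exists>q\<in>?P. card {u \<in> ?P \<union> {x, y}. A q u} < m" using fo by (intro bexI[of _ a]) auto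
  qed (use assms D d in \<open>auto simp: Sx_def Ty_def\<close>)
  then show ?thesis using assms by (intro attains_routes[of "[a, b]" "[a', b']" 4]) auto
qed

text \<open>As in Koenig's theorem: unless one vertex meets all of \<open>Sx \<inter> Ty\<close> and
  all arcs from \<open>Sx\<close> to \<open>Ty\<close>, two of these objects are disjoint and serve
  as routes.\<close>

theorem attains_ge_three:
  assumes r: "3 \<le> r" "r + 2 \<le> card W"
  shows "attains r"
proof (cases "r = 3 \<or> (\<exists>v. (Sx - {v}) \<inter> (Ty - {v}) = {} \<and> (\<forall>a\<in>Sx - {v}. \<forall>b\<in>Ty - {v}. \<not> A a b))")
  case True
  then show ?thesis
  proof
    assume "\<exists>v. (Sx - {v}) \<inter> (Ty - {v}) = {} \<and> (\<forall>a\<in>Sx - {v}. \<forall>b\<in>Ty - {v}. \<not> A a b)"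
    then obtain v where "(Sx - {v}) \<inter> (Ty - {v}) = {}" "\<forall>a\<in>Sx - {v}. \<forall>b\<in>Ty - {v}. \<not> A a b" by blast
    then show ?thesis by (intro attains_separated[OF refl refl _ _ r]) auto
  qed (use attains_three in simp)
next
  case False
  then have r4: "4 \<le> r" using r by simp
  have link: "(\<exists>z \<in> Sx \<inter> Ty. z \<noteq> v) \<or> (\<exists>a\<in>Sx. \<exists>b\<in>Ty. a \<noteq> v \<and> b \<noteq> v \<and> A a b)" for v
    using False by blast
  show ?thesis
  proof (cases "Sx \<inter> Ty = {}")
    case False
    then obtain z where z: "z \<in> Sx \<inter> Ty" by blast
    then show ?thesis
      using link[of z] attains_two_vertices[OF z _ _ r4 r(2)] attains_vertex_and_arc[OF z _ _ _ _ _ r4 r(2)]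
      by (elim disjE bexE) blast+
  next
    case True
    note two = attains_two_arcs[OF True _ _ _ _ _ _ _ _ r4 r(2)]
    \<comment> \<open>\<open>x\<close> lies in neither \<open>Sx\<close> nor \<open>Ty\<close>, so
      \<open>link\<close> merely supplies some arc here.\<close>
    obtain a b where ab: "a \<in> Sx" "b \<in> Ty" "A a b" using link[of x] True by blast
    obtain a' b' where ab': "a' \<in> Sx" "b' \<in> Ty" "A a' b'" "a' \<noteq> a" using link[of a] True by blast
    obtain a2 b2 where ab2: "a2 \<in> Sx" "b2 \<in> Ty" "A a2 b2" "b2 \<noteq> b" using link[of b] True by blast
    show ?thesis
    proof (cases "b' = b")
      case False
      then show ?thesis using two[OF ab ab'(1-3)] ab'(4) by metis
    next
      case b'b: True
      \<comment> \<open>The arc from \<open>a'\<close> to \<open>b\<close> avoids \<open>a\<close>,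
        and the arc from \<open>a2\<close> to \<open>b2\<close> avoids \<open>b\<close>. They are
        disjoint if \<open>a2 = a\<close>; otherwise the latter is disjoint from the arc from
        \<open>a\<close> to \<open>b\<close>.\<close>
      show ?thesis
      proof (cases "a2 = a")
        case True
        then show ?thesis using two[OF ab2(1-3) ab'(1-3)] ab'(4) ab2(4) b'b by metis
      next
        case False
        then show ?thesis using two[OF ab ab2(1-3)] ab2(4) by metis
      qed
    qed
  qed
qed

end

section \<open>Deleting \<open>S\<close> from the regular tournament\<close>

theorem theorem1p5:
  fixes V :: "'a set" and A :: "'a \<Rightarrow> 'a \<Rightarrow> bool" and S :: "'a set"
    and n r :: nat and x y :: 'a
  assumes "regular_tournament V A"
    and "card V = 2 * n + 1" and "2 * n + 1 \<ge> 11"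
    and "S \<subseteq> V" and "2 * card S \<le> n - 2"
    and "x \<in> V - S" and "y \<in> V - S" and "x \<noteq> y"
    and "3 \<le> r" and "r \<le> 2 * n - card S - 1"
    and "has_path (V - S) A x y r"
  shows "has_path (V - S) A x y (r + 1)"
proof -
  have "tournament V A" using assms(1) by (simp add: regular_tournament_def)
  then have finV: "finite V" and irr: "\<not> A v v"
    and tot: "u \<in> V \<Longrightarrow> v \<in> V \<Longrightarrow> u \<noteq> v \<Longrightarrow> A u v \<longleftrightarrow> \<not> A v u" for u v
    unfolding tournament_def by blast+
  have finS: "finite S" using finV assms(4) finite_subset by blast
  have cW: "card (V - S) + card S = 2 * n + 1"
    using assms(2,4) finS card_mono[OF finV assms(4)] by (simp add: card_Diff_subset)
  have deg: "card {w \<in> V. A v w} = n" "card {w \<in> V. A w v} = n" if v: "v \<in> V" for v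
  proof -
    have "{w \<in> V. A v w} \<union> {w \<in> V. A w v} = V - {v}" using v tot irr by blast
    moreover have "{w \<in> V. A v w} \<inter> {w \<in> V. A w v} = {}" using v tot irr by blast
    ultimately have "card {w \<in> V. A v w} + card {w \<in> V. A w v} = 2 * n"
      using card_Un_disjoint[of "{w \<in> V. A v w}" "{w \<in> V. A w v}"] finV v assms(2) by simp
    moreover have "card {w \<in> V. A v w} = card {w \<in> V. A w v}"
      using assms(1) v by (auto simp: regular_tournament_def outdeg_def indeg_def)
    ultimately show "card {w \<in> V. A v w} = n" "card {w \<in> V. A w v} = n" by linarith+
  qed
  \<comment> \<open>Deleting \<open>S\<close> lowers a semidegree by at most \<open>card S\<close>;
    \<open>R\<close> stands for either direction of the arcs.\<close>
  have cut: "n - card S \<le> card {w \<in> V - S. R w}" if "card {w \<in> V. R w} = n" for R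
  proof -
    have "card {w \<in> V. R w} \<le> card ({w \<in> V - S. R w} \<union> S)" using finV finS by (intro card_mono) auto
    also have "\<dots> \<le> card {w \<in> V - S. R w} + card S" by (rule card_Un_le)
    finally show ?thesis using that by simp
  qed
  have small: "2 * card S + 2 \<le> n" "5 \<le> n" using assms(3,5) by simp_all
  interpret terminals "V - S" A x y "n - card S"
  proof unfold_locales
    show "n - card S \<le> card {w \<in> V - S. A v w}" "n - card S \<le> card {w \<in> V - S. A w v}"
      if "v \<in> V - S" for v using that deg[of v] cut by auto
    show "A u v \<longleftrightarrow> \<not> A v u" if "u \<in> V - S" "v \<in> V - S" "u \<noteq> v" for u v
      by (rule tot) (use that in simp_all)
    \<comment> \<open>By \<open>cW\<close> the first inequality is
      \<open>2 * card S + 2 \<le> n\<close>; the second is tight for \<open>n = 5\<close>,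
      \<open>card S = 1\<close> and for \<open>n = 6\<close>, \<open>card S = 2\<close>.\<close>
    show "card (V - S) + 1 \<le> 3 * (n - card S)" "4 \<le> n - card S"
      using small cW by simp_all
  qed (use assms(6-8) finV irr in simp_all)
  \<comment> \<open>The upper bound on \<open>r\<close> is exactly
    \<open>r + 2 \<le> card (V - S)\<close>, and \<open>r\<close> inner vertices make a path of
    length \<open>r + 1\<close>.\<close>
  have "attains r" using assms(9,10) small cW by (intro attains_ge_three) simp_all
  then show ?thesis using has_path_if_spans[OF _ _ assms(6,7,8)] unfolding attains_def by blast
qed

end
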